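(* Let $G$ be a connected and simply connected Lie group with Lie algebra $\mathcal G$, let $R:G\to \mathrm{GL}(E)$ be a linear representation of $G$ in a finite-dimensional real vector space $E$, and let $r:\mathcal G\to\mathfrak{gl}(E)$ be the associated linear representation of $\mathcal G$. For any one-cocycle $\Theta:\mathcal G\to E$ of the Lie algebra $\mathcal G$ for the linear representation $r$, there exists a unique one-cocycle $\theta:G\to E$ of the Lie group $G$ for the linear representation $R$ such that $\Theta=T_e\theta$ (where $e\in G$ is the neutral element). Moreover, the Lie group one-cocycle $\theta$ is a Lie group one-coboundary if and only if the Lie algebra one-cocycle $\Theta$ is a Lie algebra one-coboundary.
   Context: A linear representation of a Lie group $G$ in $E$ is a Lie group homomorphism $R:G\to\mathrm{GL}(E)$; the associated representation of the Lie algebra $\mathcal G=T_eG$ (with the bracket of left-invariant vector fields) is $r=T_eR:\mathcal G\to\mathfrak{gl}(E)$, where $\mathfrak{gl}(E)$ carries the bracket $[f_1,f_2]=f_1\circ f_2-f_2\circ f_1$. A one-cocycle of $G$ with values in $E$ for $R$ is a smooth map $\theta:G\to E$ such that $\theta(gh)=R(g)(\theta(h))+\theta(g)$ for all $g,h\in G$. It is a one-coboundary if there is a fixed $c\in E$ with $\theta(g)=R(g)(c)-c$ for all $g\in G$. A one-cocycle of $\mathcal G$ with values in $E$ for $r$ is a linear map $\Theta:\mathcal G\to E$ such that $\Theta([X,Y])=r(X)(\Theta(Y))-r(Y)(\Theta(X))$ for all $X,Y\in\mathcal G$. It is a one-coboundary if there is a fixed $c\in E$ with $\Theta(X)=r(X)(c)$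 for all $X\in\mathcal G$. The tangent space to $E$ at any point is identified with $E$. *)

theory Defs
  imports "HOL-Analysis.Analysis" "HOL-Algebra.Group"
begin

text \<open>
  Finite-dimensional real vector spaces. Unlike \<^class>\<open>euclidean_space\<close> this class admits the
  zero space. The norm is auxiliary: in finite dimension all norms are equivalent, every linear map
  is bounded, and every space carries a norm.
\<close>
class fin_dim_normed_vector = real_normed_vector +
  assumes ex_finite_span: "\<exists>B. finite B \<and> (\<forall>x. \<exists>u. x = (\<Sum>b\<in>B. u b *\<^sub>R b))"

instance euclidean_space \<subseteq> fin_dim_normed_vector
  by standard (metis euclidean_representation finite_Basis)

text \<open>
  \<open>Ck_on k S f\<close>: \<open>f\<close> is of class \<open>C\<^sup>k\<close> on \<open>S\<close>. Only meant for open \<open>S\<close> and finite-dimensional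
  domains, where continuity of all directional derivatives of order up to \<open>k\<close> is enough.
\<close>
primrec Ck_on :: "nat \<Rightarrow> 'a::real_normed_vector set \<Rightarrow> ('a \<Rightarrow> 'b::real_normed_vector) \<Rightarrow> bool" where
  "Ck_on 0 S f \<longleftrightarrow> continuous_on S f"
| "Ck_on (Suc k) S f \<longleftrightarrow>
    (\<forall>x\<in>S. f differentiable (at x)) \<and> (\<forall>v. Ck_on k S (\<lambda>x. frechet_derivative f (at x) v))"

definition smooth_on :: "'a::real_normed_vector set \<Rightarrow> ('a \<Rightarrow> 'b::real_normed_vector) \<Rightarrow> bool" where
  "smooth_on S f \<longleftrightarrow> (\<forall>k. Ck_on k S f)"


subsection \<open>Smooth manifolds\<close>

text \<open>A chart is a pair of its domain and its coordinate map (irrelevant outside the domain).\<close>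
type_synonym ('p, 'v) chart = "'p set \<times> ('p \<Rightarrow> 'v)"

definition chart_inv :: "('p, 'v) chart \<Rightarrow> 'v \<Rightarrow> 'p" where
  "chart_inv c = inv_into (fst c) (snd c)"

definition charts_at :: "('p, 'v) chart set \<Rightarrow> 'p \<Rightarrow> ('p, 'v) chart set" where
  "charts_at A p = {c \<in> A. p \<in> fst c}"

locale smooth_manifold =
  fixes A :: "('p::{t2_space, second_countable_topology}, 'v::fin_dim_normed_vector) chart set"
  assumes open_domain: "c \<in> A \<Longrightarrow> open (fst c)"
    and open_image: "c \<in> A \<Longrightarrow> open (snd c ` fst c)"
    and chart_homeomorphism: "c \<in> A \<Longrightarrow> homeomorphism (fst c) (snd c ` fst c) (snd c) (chart_inv c)"
    and covering: "(\<Union>c\<in>A. fst c) = UNIV"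
    and smooth_transition:
      "c \<in> A \<Longrightarrow> d \<in> A \<Longrightarrow> smooth_on (snd c ` (fst c \<inter> fst d)) (snd d \<circ> chart_inv c)"

definition smooth_map ::
  "('p::topological_space, 'v::real_normed_vector) chart set \<Rightarrow>
   ('q::topological_space, 'w::real_normed_vector) chart set \<Rightarrow> ('p \<Rightarrow> 'q) \<Rightarrow> bool" where
  "smooth_map A B f \<longleftrightarrow> continuous_on UNIV f \<and>
    (\<forall>c\<in>A. \<forall>d\<in>B. smooth_on (snd c ` (fst c \<inter> f -` fst d)) (snd d \<circ> f \<circ> chart_inv c))"

definition prod_atlas ::
  "('p, 'v) chart set \<Rightarrow> ('q, 'w) chart set \<Rightarrow> ('p \<times> 'q, 'v \<times> 'w) chart set" where
  "prod_atlas A B = {(fst c \<times> fst d, map_prod (snd c) (snd d)) | c d. c \<in> A \<and> d \<in> B}"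

definition vs_atlas :: "('w, 'w) chart set" where
  "vs_atlas = {(UNIV, id)}"


subsection \<open>Tangent spaces\<close>

text \<open>
  A tangent vector at \<open>p\<close> is the family of its coordinate vectors in the charts around \<open>p\<close>; these
  transform by the derivatives of the transition maps. At charts not around \<open>p\<close> the family is
  \<open>0\<close>, so that equality of tangent vectors is equality of functions. The vector space operations
  are pointwise.
\<close>
type_synonym ('p, 'v) tangent = "('p, 'v) chart \<Rightarrow> 'v"

definition tangent_space ::
  "('p, 'v::real_normed_vector) chart set \<Rightarrow> 'p \<Rightarrow> ('p, 'v) tangent set" where
  "tangent_space A p = {X.
    (\<forall>c. c \<notin> charts_at A p \<longrightarrow> X c = 0) \<and>
    (\<forall>c\<in>charts_at A p. \<forall>d\<in>charts_at A p.
      X d = frechet_derivative (snd d \<circ> chart_inv c) (at (snd c p)) (X c))}"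

text \<open>
  The tangent map \<open>T\<^sub>p f\<close>. By the chain rule it does not depend on the chart \<open>c\<close> that is chosen
  around \<open>p\<close>.
\<close>
definition tangent_map ::
  "('p, 'v::real_normed_vector) chart set \<Rightarrow> ('q, 'w::real_normed_vector) chart set \<Rightarrow>
   ('p \<Rightarrow> 'q) \<Rightarrow> 'p \<Rightarrow> ('p, 'v) tangent \<Rightarrow> ('q, 'w) tangent" where
  "tangent_map A B f p X = (\<lambda>d.
    if d \<in> charts_at B (f p) then
      (let c = (SOME c. c \<in> charts_at A p)
       in frechet_derivative (snd d \<circ> f \<circ> chart_inv c) (at (snd c p)) (X c))
    else 0)"

text \<open>
  The tangent map of a map into a vector space \<open>W\<close>, with the tangent spaces of \<open>W\<close> identified
  with \<open>W\<close> by means of the global chart \<open>id\<close>.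
\<close>
definition vs_tangent_map ::
  "('p, 'v::real_normed_vector) chart set \<Rightarrow> ('p \<Rightarrow> 'w::real_normed_vector) \<Rightarrow> 'p \<Rightarrow>
   ('p, 'v) tangent \<Rightarrow> 'w" where
  "vs_tangent_map A f p X = tangent_map A vs_atlas f p X (UNIV, id)"

text \<open>
  The bracket of vector fields; in coordinates \<open>[V,W] = DW\<cdot>V - DV\<cdot>W\<close>, the convention for which
  \<open>[V,W] f = V (W f) - W (V f)\<close>.
\<close>
definition vf_coord ::
  "('p \<Rightarrow> ('p, 'v::real_normed_vector) tangent) \<Rightarrow> ('p, 'v) chart \<Rightarrow> 'v \<Rightarrow> 'v" where
  "vf_coord V c x = V (chart_inv c x) c"

definition vf_bracket ::
  "('p, 'v::real_normed_vector) chart set \<Rightarrow> ('p \<Rightarrow> ('p, 'v) tangent) \<Rightarrow>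
   ('p \<Rightarrow> ('p, 'v) tangent) \<Rightarrow> 'p \<Rightarrow> ('p, 'v) tangent" where
  "vf_bracket A V W p = (\<lambda>c.
    if c \<in> charts_at A p then
      frechet_derivative (vf_coord W c) (at (snd c p)) (V p c) -
      frechet_derivative (vf_coord V c) (at (snd c p)) (W p c)
    else 0)"


subsection \<open>Lie groups and their Lie algebras\<close>

locale lie_group = group G + smooth_manifold A
  for G :: "('g::{t2_space, second_countable_topology}, 'm) monoid_scheme" (structure)
    and A :: "('g, 'v::fin_dim_normed_vector) chart set" +
  assumes carrier_UNIV: "carrier G = UNIV"
    and smooth_mult: "smooth_map (prod_atlas A A) A (\<lambda>(g, h). g \<otimes> h)"
    and smooth_inv: "smooth_map A A (\<lambda>g. inv g)"

definition lie_algebra ::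
  "('g, 'm) monoid_scheme \<Rightarrow> ('g, 'v::real_normed_vector) chart set \<Rightarrow> ('g, 'v) tangent set" where
  "lie_algebra G A = tangent_space A \<one>\<^bsub>G\<^esub>"

definition left_invariant_vf ::
  "('g, 'm) monoid_scheme \<Rightarrow> ('g, 'v::real_normed_vector) chart set \<Rightarrow>
   ('g, 'v) tangent \<Rightarrow> 'g \<Rightarrow> ('g, 'v) tangent" where
  "left_invariant_vf G A X g = tangent_map A A (\<lambda>h. g \<otimes>\<^bsub>G\<^esub> h) \<one>\<^bsub>G\<^esub> X"

definition lie_bracket ::
  "('g, 'm) monoid_scheme \<Rightarrow> ('g, 'v::real_normed_vector) chart set \<Rightarrow>
   ('g, 'v) tangent \<Rightarrow> ('g, 'v) tangent \<Rightarrow> ('g, 'v) tangent" where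
  "lie_bracket G A X Y =
    vf_bracket A (left_invariant_vf G A X) (left_invariant_vf G A Y) \<one>\<^bsub>G\<^esub>"


subsection \<open>Representations and one-cocycles\<close>

definition GL :: "('e::real_normed_vector \<Rightarrow>\<^sub>L 'e) monoid" where
  "GL = \<lparr>carrier = {f. \<exists>h. f o\<^sub>L h = id_blinfun \<and> h o\<^sub>L f = id_blinfun},
         mult = (o\<^sub>L), one = id_blinfun\<rparr>"

text \<open>\<open>GL(E)\<close> is an open subset of the vector space of endomorphisms of \<open>E\<close>, whose global chart
  therefore serves for smoothness of maps into \<open>GL(E)\<close> and for their tangent maps.\<close>
definition lie_group_rep ::
  "('g::topological_space, 'm) monoid_scheme \<Rightarrow> ('g, 'v::real_normed_vector) chart set \<Rightarrow>
   ('g \<Rightarrow> 'e::fin_dim_normed_vector \<Rightarrow>\<^sub>L 'e) \<Rightarrow> bool" where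
  "lie_group_rep G A R \<longleftrightarrow> R \<in> hom G GL \<and> smooth_map A vs_atlas R"

definition lie_algebra_rep ::
  "('g, 'm) monoid_scheme \<Rightarrow> ('g, 'v::real_normed_vector) chart set \<Rightarrow>
   ('g \<Rightarrow> 'e::fin_dim_normed_vector \<Rightarrow>\<^sub>L 'e) \<Rightarrow> ('g, 'v) tangent \<Rightarrow> 'e \<Rightarrow>\<^sub>L 'e" where
  "lie_algebra_rep G A R X = vs_tangent_map A R \<one>\<^bsub>G\<^esub> X"

definition lie_group_cocycle ::
  "('g::topological_space, 'm) monoid_scheme \<Rightarrow> ('g, 'v::real_normed_vector) chart set \<Rightarrow>
   ('g \<Rightarrow> 'e::fin_dim_normed_vector \<Rightarrow>\<^sub>L 'e) \<Rightarrow> ('g \<Rightarrow> 'e) \<Rightarrow> bool" where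
  "lie_group_cocycle G A R \<theta> \<longleftrightarrow> smooth_map A vs_atlas \<theta> \<and>
    (\<forall>g\<in>carrier G. \<forall>h\<in>carrier G. \<theta> (g \<otimes>\<^bsub>G\<^esub> h) = blinfun_apply (R g) (\<theta> h) + \<theta> g)"

definition lie_group_coboundary ::
  "('g, 'm) monoid_scheme \<Rightarrow> ('g \<Rightarrow> 'e::fin_dim_normed_vector \<Rightarrow>\<^sub>L 'e) \<Rightarrow> ('g \<Rightarrow> 'e) \<Rightarrow> bool" where
  "lie_group_coboundary G R \<theta> \<longleftrightarrow> (\<exists>c. \<forall>g\<in>carrier G. \<theta> g = blinfun_apply (R g) c - c)"

definition lie_algebra_cocycle ::
  "('g, 'm) monoid_scheme \<Rightarrow> ('g, 'v::real_normed_vector) chart set \<Rightarrow>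
   (('g, 'v) tangent \<Rightarrow> 'e::fin_dim_normed_vector \<Rightarrow>\<^sub>L 'e) \<Rightarrow> (('g, 'v) tangent \<Rightarrow> 'e) \<Rightarrow> bool" where
  "lie_algebra_cocycle G A r \<Theta> \<longleftrightarrow>
    (\<forall>X\<in>lie_algebra G A. \<forall>Y\<in>lie_algebra G A. \<Theta> (\<lambda>c. X c + Y c) = \<Theta> X + \<Theta> Y) \<and>
    (\<forall>X\<in>lie_algebra G A. \<forall>a. \<Theta> (\<lambda>c. a *\<^sub>R X c) = a *\<^sub>R \<Theta> X) \<and>
    (\<forall>X\<in>lie_algebra G A. \<forall>Y\<in>lie_algebra G A.
      \<Theta> (lie_bracket G A X Y) = blinfun_apply (r X) (\<Theta> Y) - blinfun_apply (r Y) (\<Theta> X))"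

definition lie_algebra_coboundary ::
  "('g, 'm) monoid_scheme \<Rightarrow> ('g, 'v::real_normed_vector) chart set \<Rightarrow>
   (('g, 'v) tangent \<Rightarrow> 'e::fin_dim_normed_vector \<Rightarrow>\<^sub>L 'e) \<Rightarrow> (('g, 'v) tangent \<Rightarrow> 'e) \<Rightarrow> bool" where
  "lie_algebra_coboundary G A r \<Theta> \<longleftrightarrow> (\<exists>c. \<forall>X\<in>lie_algebra G A. \<Theta> X = blinfun_apply (r X) c)"

text \<open>\<open>\<Theta> = T\<^sub>e \<theta>\<close>, as maps on the Lie algebra.\<close>
definition integrates ::
  "('g, 'm) monoid_scheme \<Rightarrow> ('g, 'v::real_normed_vector) chart set \<Rightarrow>
   ('g \<Rightarrow> 'e::fin_dim_normed_vector) \<Rightarrow> (('g, 'v) tangent \<Rightarrow> 'e) \<Rightarrow> bool" where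
  "integrates G A \<theta> \<Theta> \<longleftrightarrow> (\<forall>X\<in>lie_algebra G A. \<Theta> X = vs_tangent_map A \<theta> \<one>\<^bsub>G\<^esub> X)"

end

theory Submission
  imports Defs
begin

text \<open>
  The cocycle \<open>\<Theta>\<close> extends to an \<open>E\<close>-valued one-form \<open>\<omega>\<close> on \<open>G\<close>: at \<open>g\<close> it is \<open>R(g)\<close> applied to
  \<open>\<Theta>\<close> of the Maurer-Cartan form, which carries a tangent vector at \<open>g\<close> back to \<open>e\<close> by left translation.
  Two facts about \<open>\<omega>\<close> carry everything.

  First, a smooth map \<open>\<theta>\<close> is a group cocycle with \<open>T\<^sub>e\<theta> = \<Theta>\<close> exactly if \<open>d\<theta> = \<omega>\<close> and \<open>\<theta>(e) = 0\<close>.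
  Differentiating \<open>\<theta>(k) = R(g)(\<theta>(g\<^sup>-\<^sup>1k)) + \<theta>(g)\<close> at \<open>k = g\<close> gives \<open>d\<theta> = \<omega>\<close>
  (\<open>cocycle_imp_primitive\<close>). Conversely, \<open>\<omega>\<close> is left-equivariant, so that \<open>h \<mapsto> \<theta>(gh)\<close> and
  \<open>h \<mapsto> R(g)(\<theta>(h))\<close> have the same derivative whenever \<open>d\<theta> = \<omega>\<close>, and on the connected group \<open>G\<close> they
  differ by the constant \<open>\<theta>(g)\<close>, their difference at \<open>h = e\<close> (\<open>primitive_imp_cocycle\<close>). As primitives on
  a connected manifold are determined up to a constant, uniqueness follows. The statement on coboundaries
  is uniqueness again: \<open>g \<mapsto> R(g)(c) - c\<close> is a group cocycle whose tangent map at \<open>e\<close> is \<open>X \<mapsto> r(X)(c)\<close>.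

  Secondly, \<open>\<omega>\<close> is closed, so that a primitive exists. On left-invariant fields \<open>\<omega>\<close> takes the values
  \<open>R(g)(\<Theta>(X))\<close>, and differentiating these at \<open>e\<close> turns \<open>d\<omega>(X, Y)\<close> into
  \<open>r(X)(\<Theta>(Y)) - r(Y)(\<Theta>(X)) - \<Theta>([X,Y]) = 0\<close> (\<open>form_closed_at_one\<close>); closedness then spreads over
  \<open>G\<close> by equivariance (\<open>form_closed\<close>). The Poincare lemma gives primitives on coordinate balls
  (\<open>poincare_convex\<close>), and continuing them along paths gives a global one, because \<open>G\<close> is simply
  connected (\<open>global_section\<close>). Its derivative is the smooth form \<open>\<omega>\<close>, whence it is smooth.

  Symmetry of second derivatives enters twice, both times because a coordinate expression has to be
  natural under smooth maps: the exterior derivative of \<open>\<omega>\<close> under left translations, and the bracket of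
  vector fields under changes of charts (\<open>closed_pushforward\<close>, \<open>bracket_pushforward\<close>). The latter puts \<open>[X,Y]\<close>, which is defined chart by chart, into the Lie algebra, where \<open>\<Theta>\<close> is known to be linear.
\<close>

section \<open>Finite-dimensional normed spaces\<close>

lemma norm_ge_infdist:
  fixes a :: "'a::real_normed_vector"
  assumes S: "subspace S" and s: "s \<in> S"
  shows "\<bar>t\<bar> * infdist a S \<le> norm (s + t *\<^sub>R a)"
proof (cases "t = 0")
  case False
  have "- (s /\<^sub>R t) \<in> S" using S s by (simp add: subspace_neg subspace_scale)
  then have "infdist a S \<le> norm (a - - (s /\<^sub>R t))"
    using infdist_le[of "- (s /\<^sub>R t)" S a] by (simp only: dist_norm)
  then have "\<bar>t\<bar> * infdist a S \<le> norm (t *\<^sub>R (a + s /\<^sub>R t))"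
    by (simp add: mult_left_mono)
  also have "t *\<^sub>R (a + s /\<^sub>R t) = s + t *\<^sub>R a"
    using False by (simp add: scaleR_add_right)
  finally show ?thesis .
qed simp

text \<open>
  The coefficient of \<open>a\<close> is bounded by the norm because \<open>a\<close> has positive distance from the closed
  subspace \<open>S\<close>. So the coefficients of a Cauchy sequence converge, and what remains of it is a Cauchy
  sequence in \<open>S\<close>.
\<close>
lemma complete_span_insert:
  fixes a :: "'a::real_normed_vector"
  assumes S: "subspace S" "complete S"
  shows "complete (span (insert a S))"
proof (cases "a \<in> S")
  case True
  then show ?thesis using S by (simp add: insert_absorb span_eq_iff[THEN iffD2])
next
  case False
  define d where "d = infdist a S"
  have d: "d > 0"
    unfolding d_def using S False subspace_0
    by (intro infdist_pos_not_in_closed) (auto simp: complete_imp_closed)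
  have "\<exists>t. x - t *\<^sub>R a \<in> S" if "x \<in> span (insert a S)" for x
    using that S by (simp add: span_insert span_eq_iff[THEN iffD2])
  then obtain \<tau> where \<tau>: "x - \<tau> x *\<^sub>R a \<in> S" if "x \<in> span (insert a S)" for x by metis
  show ?thesis
    unfolding complete_def
  proof (intro allI impI, elim conjE)
    fix X :: "nat \<Rightarrow> 'a" assume X: "\<forall>n. X n \<in> span (insert a S)" "Cauchy X"
    have coeff: "\<bar>\<tau> (X m) - \<tau> (X n)\<bar> * d \<le> norm (X m - X n)" for m n
    proof -
      have "(X m - \<tau> (X m) *\<^sub>R a) - (X n - \<tau> (X n) *\<^sub>R a) \<in> S"
        using X(1) by (intro subspace_diff S(1) \<tau>) simp_all
      from norm_ge_infdist[OF S(1) this, of "\<tau> (X m) - \<tau> (X n)" a]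
      show ?thesis by (simp add: d_def algebra_simps)
    qed
    have C\<tau>: "Cauchy (\<lambda>n. \<tau> (X n))"
    proof (rule metric_CauchyI)
      fix e :: real assume "e > 0"
      then obtain M where M: "\<And>m n. m \<ge> M \<Longrightarrow> n \<ge> M \<Longrightarrow> dist (X m) (X n) < e * d"
        using X(2) d metric_CauchyD[of X "e * d"] by auto
      have "dist (\<tau> (X m)) (\<tau> (X n)) < e" if "m \<ge> M" "n \<ge> M" for m n
      proof -
        have "\<bar>\<tau> (X m) - \<tau> (X n)\<bar> * d < e * d"
          using coeff[of m n] M[OF that] by (simp add: dist_norm)
        then show ?thesis using d by (simp add: dist_real_def)
      qed
      then show "\<exists>M. \<forall>m\<ge>M. \<forall>n\<ge>M. dist (\<tau> (X m)) (\<tau> (X n)) < e" by blast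
    qed
    then obtain t where t: "(\<lambda>n. \<tau> (X n)) \<longlonglongrightarrow> t"
      using Cauchy_convergent_iff convergent_def by blast
    have "Cauchy (\<lambda>n. X n - \<tau> (X n) *\<^sub>R a)"
    proof -
      have C: "Cauchy (\<lambda>n. \<tau> (X n) *\<^sub>R a)"
        by (rule bounded_linear.Cauchy[OF bounded_linear_scaleR_left C\<tau>])
      show ?thesis
      proof (rule metric_CauchyI)
        fix e :: real assume "e > 0"
        then have "e / 2 > 0" by simp
        with X(2) C obtain M N where MN: "\<And>m n. m \<ge> M \<Longrightarrow> n \<ge> M \<Longrightarrow> dist (X m) (X n) < e / 2"
          "\<And>m n. m \<ge> N \<Longrightarrow> n \<ge> N \<Longrightarrow> dist (\<tau> (X m) *\<^sub>R a) (\<tau> (X n) *\<^sub>R a) < e / 2"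
          by (meson metric_CauchyD)
        have "dist (X m - \<tau> (X m) *\<^sub>R a) (X n - \<tau> (X n) *\<^sub>R a) < e"
          if "m \<ge> max M N" "n \<ge> max M N" for m n
        proof -
          have "norm ((X m - X n) - (\<tau> (X m) *\<^sub>R a - \<tau> (X n) *\<^sub>R a)) < e"
            using MN(1)[of m n] MN(2)[of m n] that
              norm_triangle_ineq4[of "X m - X n" "\<tau> (X m) *\<^sub>R a - \<tau> (X n) *\<^sub>R a"]
            by (simp add: dist_norm)
          then show ?thesis by (simp add: dist_norm algebra_simps)
        qed
        then show "\<exists>M. \<forall>m\<ge>M. \<forall>n\<ge>M. dist (X m - \<tau> (X m) *\<^sub>R a) (X n - \<tau> (X n) *\<^sub>R a) < e"
          by blast
      qed
    qed
    then obtain s where s: "s \<in> S" "(\<lambda>n. X n - \<tau> (X n) *\<^sub>R a) \<longlonglongrightarrow> s"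
      using S(2) X(1) \<tau> unfolding complete_def by (metis (no_types, lifting))
    have "(\<lambda>n. (X n - \<tau> (X n) *\<^sub>R a) + \<tau> (X n) *\<^sub>R a) \<longlonglongrightarrow> s + t *\<^sub>R a"
      by (intro tendsto_intros s t)
    moreover have "s + t *\<^sub>R a \<in> span (insert a S)"
      by (intro span_add span_scale) (auto intro: span_base s)
    ultimately show "\<exists>l\<in>span (insert a S). X \<longlonglongrightarrow> l" by auto
  qed
qed

lemma complete_span_finite:
  fixes B :: "'a::real_normed_vector set"
  shows "finite B \<Longrightarrow> complete (span B)"
proof (induction rule: finite_induct)
  case empty
  then show ?case by (simp add: compact_imp_complete)
next
  case (insert a B)
  then have "complete (span (insert a (span B)))"
    by (intro complete_span_insert) auto
  moreover have "span (insert a (span B)) = span (insert a B)"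
    by (simp only: span_insert span_span)
  ultimately show ?case by simp
qed

lemma fin_dim_span:
  obtains B :: "'a::fin_dim_normed_vector set" where "finite B" "span B = UNIV"
proof -
  obtain B :: "'a set" where B: "finite B" "\<And>x. \<exists>u. x = (\<Sum>b\<in>B. u b *\<^sub>R b)"
    using ex_finite_span by metis
  have "x \<in> span B" for x
    using B(2)[of x] by (auto intro!: span_sum span_scale intro: span_base)
  then show ?thesis using B(1) that by blast
qed

text \<open>
  Completeness is what integrals with values in \<open>E\<close> need; they occur in the Poincare lemma.
\<close>
instance fin_dim_normed_vector \<subseteq> banach
proof
  fix X :: "nat \<Rightarrow> 'a" assume "Cauchy X"
  obtain B :: "'a set" where B: "finite B" "span B = UNIV" by (rule fin_dim_span)
  then have "complete (UNIV :: 'a set)" using complete_span_finite by metis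
  then show "convergent X" using \<open>Cauchy X\<close> unfolding complete_def convergent_def by auto
qed

text \<open>
  Bounded coordinate functionals reduce a map that is linear in a vector argument to finitely many
  values of that argument. This is how smoothness for each fixed argument becomes smoothness in the
  operator norm.
\<close>
lemma fin_dim_coordinates:
  obtains B :: "'a::fin_dim_normed_vector set" and \<phi> :: "'a \<Rightarrow> 'a \<Rightarrow>\<^sub>L real"
  where "finite B" "\<forall>x. (\<Sum>b\<in>B. \<phi> b x *\<^sub>R b) = x"
proof -
  obtain B0 :: "'a set" where B0: "finite B0" "span B0 = UNIV" by (rule fin_dim_span)
  obtain B where B: "B \<subseteq> B0" "independent B" "B0 \<subseteq> span B"
    using maximal_independent_subset[of B0] by blast
  have fin: "finite B" using B(1) B0(1) by (rule finite_subset)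
  have sp: "span B = UNIV" using span_mono[OF B(3)] B0(2) by (simp only: span_span top.extremum_unique)
  define c where "c b x = representation B x b" for b x
  have sum: "(\<Sum>b\<in>B. c b x *\<^sub>R b) = x" for x
    unfolding c_def using real_vector.sum_representation_eq[OF B(2) _ fin order_refl, of x] sp by auto
  have "bounded_linear (c b)" if b: "b \<in> B" for b
  proof -
    let ?S = "span (B - {b})"
    define d where "d = infdist b ?S"
    have "closed ?S" using complete_span_finite[of "B - {b}"] fin by (simp add: complete_imp_closed)
    moreover have "b \<notin> ?S" using B(2) b dependent_def by blast
    ultimately have d: "d > 0"
      unfolding d_def using span_zero by (intro infdist_pos_not_in_closed) auto
    have bound: "norm (c b x) \<le> norm x * (1 / d)" for x
    proof -
      have "(\<Sum>b'\<in>B - {b}. c b' x *\<^sub>R b') \<in> ?S"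
        by (intro span_sum span_scale) (auto intro: span_base)
      from norm_ge_infdist[OF subspace_span this, of "c b x" b]
      have "\<bar>c b x\<bar> * d \<le> norm x"
        using sum[of x] sum.remove[OF fin b, of "\<lambda>b. c b x *\<^sub>R b"] by (simp add: d_def add.commute)
      then show ?thesis using d by (simp add: field_simps)
    qed
    show ?thesis
    proof (rule bounded_linear_intro[OF _ _ bound])
      show "c b (x + y) = c b x + c b y" for x y
        unfolding c_def using B(2) sp by (simp add: real_vector.representation_add)
      show "c b (r *\<^sub>R x) = r *\<^sub>R c b x" for r x
        unfolding c_def using B(2) sp by (simp add: real_vector.representation_scale)
    qed
  qed
  then have "blinfun_apply (Blinfun (c b)) = c b" if "b \<in> B" for b
    using that bounded_linear_Blinfun_apply by blast
  then have "(\<Sum>b\<in>B. blinfun_apply (Blinfun (c b)) x *\<^sub>R b) = x" for x using sum by simp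
  then have "\<forall>x. (\<Sum>b\<in>B. blinfun_apply (Blinfun (c b)) x *\<^sub>R b) = x" by blast
  then show ?thesis by (rule that[of B "\<lambda>b. Blinfun (c b)", OF fin])
qed

lemma fin_dim_linear_expansion:
  fixes f :: "'a::fin_dim_normed_vector \<Rightarrow> 'b::real_normed_vector"
  assumes "linear f" "\<forall>x. (\<Sum>b\<in>B. \<phi> b x *\<^sub>R b) = x"
  shows "f x = (\<Sum>b\<in>B. \<phi> b x *\<^sub>R f b)"
proof -
  have "f x = f (\<Sum>b\<in>B. \<phi> b x *\<^sub>R b)" by (simp add: assms(2))
  then show ?thesis using assms(1) by (simp add: linear_sum linear_scale)
qed

lemma fin_dim_linear_imp_bounded_linear:
  fixes f :: "'a::fin_dim_normed_vector \<Rightarrow> 'b::real_normed_vector"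
  assumes "linear f"
  shows "bounded_linear f"
proof -
  obtain B :: "'a set" and \<phi> :: "'a \<Rightarrow> 'a \<Rightarrow>\<^sub>L real" where B: "finite B" "\<forall>x. (\<Sum>b\<in>B. \<phi> b x *\<^sub>R b) = x"
    by (rule fin_dim_coordinates)
  have "f = (\<lambda>x. \<Sum>b\<in>B. \<phi> b x *\<^sub>R f b)"
    using fin_dim_linear_expansion[OF assms B(2)] by (rule ext)
  moreover have "bounded_linear (\<lambda>x. \<Sum>b\<in>B. \<phi> b x *\<^sub>R f b)"
    by (intro bounded_linear_sum bounded_linear_compose[OF bounded_linear_scaleR_left] blinfun.bounded_linear_right)
  ultimately show ?thesis by simp
qed

instance prod :: (fin_dim_normed_vector, fin_dim_normed_vector) fin_dim_normed_vector
proof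
  obtain B :: "'a set" and \<phi> :: "'a \<Rightarrow> 'a \<Rightarrow>\<^sub>L real" where B: "finite B" "\<forall>x. (\<Sum>b\<in>B. \<phi> b x *\<^sub>R b) = x"
    by (rule fin_dim_coordinates)
  obtain C :: "'b set" and \<psi> :: "'b \<Rightarrow> 'b \<Rightarrow>\<^sub>L real" where C: "finite C" "\<forall>x. (\<Sum>b\<in>C. \<psi> b x *\<^sub>R b) = x"
    by (rule fin_dim_coordinates)
  let ?K = "(\<lambda>b. (b, 0)) ` B \<union> (\<lambda>c. (0, c)) ` C"
  have "z \<in> span ?K" for z
  proof -
    have "z = (\<Sum>b\<in>B. \<phi> b (fst z) *\<^sub>R (b, 0)) + (\<Sum>c\<in>C. \<psi> c (snd z) *\<^sub>R (0, c))"
      by (simp add: prod_eq_iff fst_sum snd_sum B C)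
    also have "\<dots> \<in> span ?K"
      by (intro span_add span_sum span_scale) (auto intro: span_base)
    finally show ?thesis .
  qed
  moreover have "finite ?K" using B C by simp
  ultimately show "\<exists>K::('a \<times> 'b) set. finite K \<and> (\<forall>x. \<exists>u. x = (\<Sum>b\<in>K. u b *\<^sub>R b))"
    using span_finite[of ?K] by (intro exI[of _ ?K]) auto
qed

section \<open>Calculus of smooth maps\<close>

lemma Ck_on_cong:
  assumes "open S" "\<And>x. x \<in> S \<Longrightarrow> f x = g x" "Ck_on k S f"
  shows "Ck_on k S g"
  using assms(2,3)
proof (induction k arbitrary: f g)
  case 0
  then show ?case by (auto cong: continuous_on_cong)
next
  case (Suc k)
  have diff: "f differentiable (at x)" if "x \<in> S" for x using Suc.prems that by simp
  have "g differentiable (at x)" if "x \<in> S" for x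
  proof -
    obtain D where "(f has_derivative D) (at x)" using diff[OF \<open>x \<in> S\<close>] unfolding differentiable_def by blast
    then have "(g has_derivative D) (at x)"
      by (rule has_derivative_transform_within_open[OF _ assms(1) \<open>x \<in> S\<close> Suc.prems(1)])
    then show ?thesis unfolding differentiable_def by blast
  qed
  moreover have "Ck_on k S (\<lambda>x. frechet_derivative g (at x) v)" for v
  proof (rule Suc.IH)
    show "Ck_on k S (\<lambda>x. frechet_derivative f (at x) v)" using Suc.prems by simp
    show "frechet_derivative f (at x) v = frechet_derivative g (at x) v" if "x \<in> S" for x
      using frechet_derivative_transform_within_open[OF diff[OF that] assms(1) that Suc.prems(1)] by simp
  qed
  ultimately show ?case by simp
qed

lemma Ck_on_subset: "Ck_on k S f \<Longrightarrow> T \<subseteq> S \<Longrightarrow> Ck_on k T f"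
  by (induction k arbitrary: f) (auto intro: continuous_on_subset)

lemma Ck_on_SucD: "Ck_on (Suc k) S f \<Longrightarrow> Ck_on k S f"
proof (induction k arbitrary: f)
  case 0
  then show ?case
    by (auto intro!: continuous_at_imp_continuous_on differentiable_imp_continuous_within)
qed simp

lemma Ck_on_local:
  assumes "\<And>x. x \<in> S \<Longrightarrow> \<exists>T. open T \<and> x \<in> T \<and> Ck_on k T f"
  shows "Ck_on k S f"
  using assms
proof (induction k arbitrary: f)
  case 0
  show ?case
    unfolding Ck_on.simps
  proof (rule continuous_at_imp_continuous_on, rule ballI)
    fix x assume "x \<in> S"
    with 0 obtain T where "open T" "x \<in> T" "continuous_on T f" by auto
    then show "isCont f x" by (simp add: continuous_on_eq_continuous_at)
  qed
next
  case (Suc k)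
  have "Ck_on k S (\<lambda>x. frechet_derivative f (at x) v)" for v
    by (rule Suc.IH) (use Suc.prems in fastforce)
  moreover have "f differentiable (at x)" if "x \<in> S" for x
    using Suc.prems[OF that] by auto
  ultimately show ?case by simp
qed

lemma Ck_on_SucI:
  assumes "open S" "\<And>x. x \<in> S \<Longrightarrow> (f has_derivative f' x) (at x)"
    and "\<And>v. Ck_on k S (\<lambda>x. f' x v)"
  shows "Ck_on (Suc k) S f"
proof -
  have "Ck_on k S (\<lambda>x. frechet_derivative f (at x) v)" for v
    by (rule Ck_on_cong[OF assms(1) _ assms(3)[of v]]) (simp add: frechet_derivative_at[OF assms(2), symmetric])
  then show ?thesis using assms(2) by (auto simp: differentiable_def)
qed

lemma Ck_on_SucE:
  assumes "Ck_on (Suc k) S f"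
  shows "\<And>x. x \<in> S \<Longrightarrow> (f has_derivative frechet_derivative f (at x)) (at x)"
    and "\<And>v. Ck_on k S (\<lambda>x. frechet_derivative f (at x) v)"
  using assms by (simp_all add: frechet_derivative_works)

lemma Ck_on_const: "open S \<Longrightarrow> Ck_on k S (\<lambda>_. c)"
proof (induction k arbitrary: c)
  case (Suc k)
  show ?case by (rule Ck_on_SucI[OF Suc.prems has_derivative_const]) (use Suc in simp)
qed simp

lemma Ck_on_bounded_linear:
  assumes "open S" "bounded_linear L" "Ck_on k S f"
  shows "Ck_on k S (\<lambda>x. L (f x))"
  using assms(3)
proof (induction k arbitrary: f)
  case 0
  then show ?case
    using bounded_linear.continuous_on[OF assms(2)] by simp
next
  case (Suc k)
  show ?case
    by (rule Ck_on_SucI[OF assms(1) bounded_linear.has_derivative[OF assms(2) Ck_on_SucE(1)[OF Suc.prems]]])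
      (auto intro!: Suc.IH Ck_on_SucE[OF Suc.prems])
qed

lemma Ck_on_add:
  assumes "open S" "Ck_on k S f" "Ck_on k S g"
  shows "Ck_on k S (\<lambda>x. f x + g x)"
  using assms(2,3)
proof (induction k arbitrary: f g)
  case (Suc k)
  show ?case
    by (rule Ck_on_SucI[OF assms(1) has_derivative_add[OF Ck_on_SucE(1)[OF Suc.prems(1)] Ck_on_SucE(1)[OF Suc.prems(2)]]])
      (auto intro!: Suc.IH Ck_on_SucE(2) Suc.prems)
qed (auto intro: continuous_intros)

lemma Ck_on_sum:
  assumes "open S" "finite I" "\<And>i. i \<in> I \<Longrightarrow> Ck_on k S (f i)"
  shows "Ck_on k S (\<lambda>x. \<Sum>i\<in>I. f i x)"
  using assms(2,3) by (induction rule: finite_induct) (auto intro!: Ck_on_add Ck_on_const assms(1))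

lemma Ck_on_bounded_bilinear:
  assumes "open S" "bounded_bilinear B" "Ck_on k S f" "Ck_on k S g"
  shows "Ck_on k S (\<lambda>x. B (f x) (g x))"
  using assms(3,4)
proof (induction k arbitrary: f g)
  case 0
  then show ?case using bounded_bilinear.continuous_on[OF assms(2)] by simp
next
  case (Suc k)
  show ?case
    by (rule Ck_on_SucI[OF assms(1) bounded_bilinear.FDERIV[OF assms(2) Ck_on_SucE(1)[OF Suc.prems(1)] Ck_on_SucE(1)[OF Suc.prems(2)]]])
      (assumption | intro Ck_on_add[OF assms(1)] Suc.IH Ck_on_SucE(2)[OF Suc.prems(1)] Ck_on_SucE(2)[OF Suc.prems(2)]
        Ck_on_SucD[OF Suc.prems(1)] Ck_on_SucD[OF Suc.prems(2)])+
qed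

lemma Ck_on_Pair:
  assumes "open S" "Ck_on k S f" "Ck_on k S g"
  shows "Ck_on k S (\<lambda>x. (f x, g x))"
  using assms(2,3)
proof (induction k arbitrary: f g)
  case (Suc k)
  show ?case
    by (rule Ck_on_SucI[OF assms(1) has_derivative_Pair[OF Ck_on_SucE(1)[OF Suc.prems(1)] Ck_on_SucE(1)[OF Suc.prems(2)]]])
      (auto intro!: Suc.IH Ck_on_SucE(2) Suc.prems)
qed (auto intro: continuous_intros)

text \<open>
  By the chain rule the derivative of \<open>g \<circ> f\<close> in direction \<open>v\<close> is \<open>Dg(f x)(Df(x) v)\<close>, where the direction
  for \<open>g\<close> depends on \<open>x\<close>. Expanding \<open>Df(x) v\<close> in coordinates leaves products with the derivatives of
  \<open>g\<close> in the fixed directions of a basis, to which the induction hypothesis applies.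
\<close>
lemma Ck_on_compose:
  fixes f :: "'a::real_normed_vector \<Rightarrow> 'b::fin_dim_normed_vector"
  assumes "open S" "f ` S \<subseteq> T" "Ck_on k S f" "Ck_on k T g"
  shows "Ck_on k S (\<lambda>x. g (f x))"
  using assms(2-4)
proof (induction k arbitrary: g)
  case 0
  then show ?case by (auto intro: continuous_on_compose2)
next
  case (Suc k)
  obtain B :: "'b set" and \<phi> :: "'b \<Rightarrow> 'b \<Rightarrow>\<^sub>L real" where B: "finite B" "\<forall>x. (\<Sum>b\<in>B. \<phi> b x *\<^sub>R b) = x"
    by (rule fin_dim_coordinates)
  note f = Ck_on_SucE[OF Suc.prems(2)] and g = Ck_on_SucE[OF Suc.prems(3)]
  show ?case
  proof (rule Ck_on_SucI[OF assms(1)])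
    fix x assume x: "x \<in> S"
    then have "f x \<in> T" using Suc.prems by blast
    then have chain: "((\<lambda>x. g (f x)) has_derivative (\<lambda>v. frechet_derivative g (at (f x)) (frechet_derivative f (at x) v))) (at x)"
      by (intro has_derivative_compose[OF f(1)[OF x]] g(1))
    have lin: "linear (frechet_derivative g (at (f x)))"
      using g(1)[OF \<open>f x \<in> T\<close>] has_derivative_linear by blast
    show "((\<lambda>x. g (f x)) has_derivative
        (\<lambda>v. \<Sum>b\<in>B. \<phi> b (frechet_derivative f (at x) v) *\<^sub>R frechet_derivative g (at (f x)) b)) (at x)"
      by (rule has_derivative_eq_rhs[OF chain]) (rule ext, rule fin_dim_linear_expansion[OF lin B(2)])
  next
    fix v
    show "Ck_on k S (\<lambda>x. \<Sum>b\<in>B. \<phi> b (frechet_derivative f (at x) v) *\<^sub>R frechet_derivative g (at (f x)) b)"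
      by (intro Ck_on_sum[OF assms(1) B(1)] Ck_on_bounded_bilinear[OF assms(1) bounded_bilinear_scaleR]
          Ck_on_bounded_linear[OF assms(1) blinfun.bounded_linear_right] Suc.IH f(2) g(2)
          Ck_on_SucD[OF Suc.prems(2)] Suc.prems(1))
  qed
qed

lemma smooth_on_imp_continuous_on: "smooth_on S f \<Longrightarrow> continuous_on S f"
  unfolding smooth_on_def using Ck_on.simps(1) by metis

lemma smooth_on_subset: "smooth_on S f \<Longrightarrow> T \<subseteq> S \<Longrightarrow> smooth_on T f"
  unfolding smooth_on_def by (auto intro: Ck_on_subset)

lemma smooth_on_cong:
  "open S \<Longrightarrow> (\<And>x. x \<in> S \<Longrightarrow> f x = g x) \<Longrightarrow> smooth_on S f \<Longrightarrow> smooth_on S g"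
  unfolding smooth_on_def using Ck_on_cong[of S f g] by simp

lemma smooth_on_local:
  "(\<And>x. x \<in> S \<Longrightarrow> \<exists>T. open T \<and> x \<in> T \<and> smooth_on T f) \<Longrightarrow> smooth_on S f"
  unfolding smooth_on_def by (rule allI, rule Ck_on_local) meson

lemma smooth_on_const: "open S \<Longrightarrow> smooth_on S (\<lambda>_. c)"
  unfolding smooth_on_def by (rule allI, rule Ck_on_const) auto

lemma smooth_on_ident: "open S \<Longrightarrow> smooth_on S (\<lambda>x. x)"
  unfolding smooth_on_def
proof
  fix k assume S: "open S"
  have "Ck_on (Suc k) S (\<lambda>x. x)"
    by (rule Ck_on_SucI[OF S has_derivative_ident Ck_on_const[OF S]])
  then show "Ck_on k S (\<lambda>x. x)" by (rule Ck_on_SucD)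
qed

lemma smooth_on_bounded_linear:
  "open S \<Longrightarrow> bounded_linear L \<Longrightarrow> smooth_on S f \<Longrightarrow> smooth_on S (\<lambda>x. L (f x))"
  unfolding smooth_on_def by (rule allI, rule Ck_on_bounded_linear) auto

lemma smooth_on_add:
  "open S \<Longrightarrow> smooth_on S f \<Longrightarrow> smooth_on S g \<Longrightarrow> smooth_on S (\<lambda>x. f x + g x)"
  unfolding smooth_on_def by (rule allI, rule Ck_on_add) auto

lemma smooth_on_sum:
  "open S \<Longrightarrow> finite I \<Longrightarrow> (\<And>i. i \<in> I \<Longrightarrow> smooth_on S (f i)) \<Longrightarrow> smooth_on S (\<lambda>x. \<Sum>i\<in>I. f i x)"
  unfolding smooth_on_def by (rule allI, rule Ck_on_sum) auto

lemma smooth_on_bounded_bilinear: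
  "open S \<Longrightarrow> bounded_bilinear B \<Longrightarrow> smooth_on S f \<Longrightarrow> smooth_on S g \<Longrightarrow> smooth_on S (\<lambda>x. B (f x) (g x))"
  unfolding smooth_on_def by (rule allI, rule Ck_on_bounded_bilinear) auto

lemma smooth_on_Pair:
  "open S \<Longrightarrow> smooth_on S f \<Longrightarrow> smooth_on S g \<Longrightarrow> smooth_on S (\<lambda>x. (f x, g x))"
  unfolding smooth_on_def by (rule allI, rule Ck_on_Pair) auto

lemma smooth_on_compose:
  fixes f :: "'a::real_normed_vector \<Rightarrow> 'b::fin_dim_normed_vector"
  shows "open S \<Longrightarrow> f ` S \<subseteq> T \<Longrightarrow> smooth_on S f \<Longrightarrow> smooth_on T g \<Longrightarrow> smooth_on S (\<lambda>x. g (f x))"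
  unfolding smooth_on_def by (rule allI, rule Ck_on_compose[where T = T]) auto

lemma smooth_on_has_derivative:
  "smooth_on S f \<Longrightarrow> x \<in> S \<Longrightarrow> (f has_derivative frechet_derivative f (at x)) (at x)"
  unfolding smooth_on_def by (rule Ck_on_SucE(1)) auto

lemma smooth_on_derivative:
  "smooth_on S f \<Longrightarrow> smooth_on S (\<lambda>x. frechet_derivative f (at x) v)"
  unfolding smooth_on_def by (intro allI Ck_on_SucE(2)) auto

lemma smooth_on_if_derivative_smooth:
  assumes "open S" "\<And>x. x \<in> S \<Longrightarrow> (f has_derivative f' x) (at x)" "\<And>v. smooth_on S (\<lambda>x. f' x v)"
  shows "smooth_on S f"
proof -
  have "Ck_on (Suc k) S f" for k
    by (rule Ck_on_SucI[OF assms(1,2)]) (use assms(3) in \<open>auto simp: smooth_on_def\<close>)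
  then show ?thesis unfolding smooth_on_def by (blast intro: Ck_on_SucD)
qed

lemma smooth_on_blinfun:
  fixes f :: "'a::real_normed_vector \<Rightarrow> 'b::fin_dim_normed_vector \<Rightarrow>\<^sub>L 'c::real_normed_vector"
  assumes "open S" "\<And>v. smooth_on S (\<lambda>x. f x v)"
  shows "smooth_on S f"
proof -
  obtain B :: "'b set" and \<phi> :: "'b \<Rightarrow> 'b \<Rightarrow>\<^sub>L real" where B: "finite B" "\<forall>x. (\<Sum>b\<in>B. \<phi> b x *\<^sub>R b) = x"
    by (rule fin_dim_coordinates)
  have eq: "(\<Sum>b\<in>B. blinfun_scaleR_left (f x b) o\<^sub>L \<phi> b) = f x" for x
  proof (rule blinfun_eqI)
    have "linear (blinfun_apply (f x))"
      using blinfun.bounded_linear_right bounded_linear.linear by blast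
    from fin_dim_linear_expansion[OF this B(2), symmetric]
    show "blinfun_apply (\<Sum>b\<in>B. blinfun_scaleR_left (f x b) o\<^sub>L \<phi> b) v = f x v" for v
      by (simp add: blinfun.sum_left)
  qed
  have "smooth_on S (\<lambda>x. \<Sum>b\<in>B. blinfun_scaleR_left (f x b) o\<^sub>L \<phi> b)"
    by (intro smooth_on_sum assms B smooth_on_const smooth_on_bounded_bilinear[OF _ bounded_bilinear_blinfun_compose]
        smooth_on_bounded_linear[OF _ bounded_linear_blinfun_scaleR_left])
  then show ?thesis by (simp only: eq)
qed

text \<open>
  The derivative as a smooth operator-valued map, which can be differentiated again as a whole.
\<close>
lemma smooth_on_blinfun_derivative:
  fixes f :: "'a::fin_dim_normed_vector \<Rightarrow> 'b::real_normed_vector"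
  assumes "open S" "smooth_on S f"
  obtains f' where "\<And>x. x \<in> S \<Longrightarrow> (f has_derivative blinfun_apply (f' x)) (at x)" "smooth_on S f'"
proof -
  define f' where "f' x = Blinfun (frechet_derivative f (at x))" for x
  have f': "blinfun_apply (f' x) = frechet_derivative f (at x)" if "x \<in> S" for x
    unfolding f'_def using smooth_on_has_derivative[OF assms(2) that]
    by (simp add: bounded_linear_Blinfun_apply has_derivative_bounded_linear)
  show ?thesis
  proof
    show "(f has_derivative blinfun_apply (f' x)) (at x)" if "x \<in> S" for x
      using smooth_on_has_derivative[OF assms(2) that] f'[OF that] by simp
    show "smooth_on S f'"
    proof (rule smooth_on_blinfun[OF assms(1)])
      show "smooth_on S (\<lambda>x. f' x v)" for v
        by (rule smooth_on_cong[OF assms(1) _ smooth_on_derivative[OF assms(2), of v]]) (simp add: f')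
    qed
  qed
qed

text \<open>
  Up to \<open>o(h\<^sup>2)\<close>, the second difference \<open>\<Delta>\<close> of \<open>f\<close> along \<open>h v\<close> and \<open>h w\<close> is \<open>h\<^sup>2 f'' w v\<close>, by the mean
  value inequality for its first difference. Since \<open>\<Delta>\<close> is symmetric in \<open>v\<close> and \<open>w\<close>, so is \<open>f''\<close>.
\<close>
lemma symmetric_second_derivative:
  fixes f :: "'a::real_normed_vector \<Rightarrow> 'b::real_normed_vector"
  assumes S: "open S" "x \<in> S"
    and f': "\<And>y. y \<in> S \<Longrightarrow> (f has_derivative blinfun_apply (f' y)) (at y)"
    and f'': "(f' has_derivative f'') (at x)"
  shows "blinfun_apply (f'' v) w = blinfun_apply (f'' w) v"
proof -
  define M where "M = 2 * (norm v + norm w) * (norm v + norm w)"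
  have M: "M \<ge> 0" by (simp add: M_def)
  interpret f'': bounded_linear f'' using f'' by (rule has_derivative_bounded_linear)
  have bound: "norm (blinfun_apply (f'' v) w - blinfun_apply (f'' w) v) \<le> 2 * (e * M)" if e: "e > 0" for e
  proof -
    obtain d where d: "d > 0" "\<And>y. norm (y - x) < d \<Longrightarrow> norm (f' y - f' x - f'' (y - x)) \<le> e * norm (y - x)"
      using f'' e unfolding has_derivative_at_alt by blast
    obtain r where r: "r > 0" "ball x r \<subseteq> S" using S open_contains_ball by blast
    \<comment> \<open>The step \<open>h\<close> keeps the parallelogram spanned at \<open>x\<close> inside \<open>S\<close> and where the estimate \<open>d\<close> holds.\<close>
    define h where "h = min d r / 2 / (norm v + norm w + 1)"
    have nvw: "norm v + norm w + 1 > 0" by (simp add: add_nonneg_pos)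
    have h: "h > 0" unfolding h_def using d r nvw by simp
    have "h * (norm v + norm w) < h * (norm v + norm w + 1)" using h by simp
    also have "\<dots> = min d r / 2"
      unfolding h_def using nvw
      by (simp only: times_divide_eq_left nonzero_divide_eq_eq less_imp_neq[symmetric] not_False_eq_True)
    finally have small: "h * (norm v + norm w) < min d r" using d r by linarith
    define \<Delta> where "\<Delta> = f (x + h *\<^sub>R v + h *\<^sub>R w) - f (x + h *\<^sub>R v) - f (x + h *\<^sub>R w) + f x"
    have half: "norm (\<Delta>' - (h * h) *\<^sub>R blinfun_apply (f'' b) a) \<le> e * M * (h * h)"
      if ab: "norm a + norm b = norm v + norm w"
        and \<Delta>': "\<Delta>' = f (x + h *\<^sub>R a + h *\<^sub>R b) - f (x + h *\<^sub>R a) - f (x + h *\<^sub>R b) + f x" for a b \<Delta>'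
    proof -
      \<comment> \<open>The first difference of \<open>f\<close> along \<open>h b\<close>, minus its expected linear growth in direction \<open>a\<close>.\<close>
      define \<phi> where "\<phi> s = f (x + s *\<^sub>R a + h *\<^sub>R b) - f (x + s *\<^sub>R a) - (s * h) *\<^sub>R blinfun_apply (f'' b) a" for s
      define \<phi>' where "\<phi>' s = blinfun_apply (f' (x + s *\<^sub>R a + h *\<^sub>R b) - f' (x + s *\<^sub>R a) - h *\<^sub>R f'' b) a" for s
      have len: "norm (s *\<^sub>R a + h' *\<^sub>R b) \<le> h * (norm v + norm w)" if "s \<in> {0..h}" "h' \<in> {0..h}" for s h'
      proof -
        have "norm (s *\<^sub>R a + h' *\<^sub>R b) \<le> s * norm a + h' * norm b"
          using that by (intro order_trans[OF norm_triangle_ineq]) simp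
        also have "\<dots> \<le> h * norm a + h * norm b"
          using that by (intro add_mono mult_right_mono) auto
        also have "\<dots> = h * (norm v + norm w)" by (simp only: ab flip: distrib_left)
        finally show ?thesis .
      qed
      have inS: "x + s *\<^sub>R a + h' *\<^sub>R b \<in> S" if "s \<in> {0..h}" "h' \<in> {0..h}" for s h'
      proof -
        have "norm (s *\<^sub>R a + h' *\<^sub>R b) < r" using len[OF that] small by linarith
        then have "x + (s *\<^sub>R a + h' *\<^sub>R b) \<in> ball x r" by (subst mem_ball, subst dist_commute) (simp add: dist_norm)
        then show ?thesis using r by (auto simp: add.assoc)
      qed
      have der: "(\<phi> has_derivative (\<lambda>t. t *\<^sub>R \<phi>' s)) (at s within {0..h})" if s: "s \<in> {0..h}" for s
      proof -
        have in1: "x + s *\<^sub>R a + h *\<^sub>R b \<in> S" using inS[OF s, of h] h by simp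
        have in2: "x + s *\<^sub>R a \<in> S" using inS[OF s, of 0] h by simp
        have 1: "((\<lambda>s. f (x + s *\<^sub>R a + h *\<^sub>R b)) has_derivative (\<lambda>t. f' (x + s *\<^sub>R a + h *\<^sub>R b) (t *\<^sub>R a))) (at s within {0..h})"
          by (rule has_derivative_compose[where f = "\<lambda>s. x + s *\<^sub>R a + h *\<^sub>R b", OF _ f'[OF in1]]) (auto intro!: derivative_eq_intros)
        have 2: "((\<lambda>s. f (x + s *\<^sub>R a)) has_derivative (\<lambda>t. f' (x + s *\<^sub>R a) (t *\<^sub>R a))) (at s within {0..h})"
          by (rule has_derivative_compose[where f = "\<lambda>s. x + s *\<^sub>R a", OF _ f'[OF in2]]) (auto intro!: derivative_eq_intros)
        show ?thesis
          unfolding \<phi>_def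
          by (rule has_derivative_eq_rhs, (rule 1 2 derivative_intros)+)
            (auto simp: \<phi>'_def blinfun.bilinear_simps algebra_simps fun_eq_iff)
      qed
      have norm\<phi>': "norm (\<phi>' s) \<le> e * M * h" if s: "s \<in> {0..h}" for s
      proof -
        have est: "norm (f' (x + y) - f' x - f'' y) \<le> e * (h * (norm v + norm w))"
          if "norm y \<le> h * (norm v + norm w)" for y
        proof -
          have "norm y < d" using that small by linarith
          then have "norm (f' (x + y) - f' x - f'' y) \<le> e * norm y" using d(2)[of "x + y"] by simp
          also have "\<dots> \<le> e * (h * (norm v + norm w))" using that e by simp
          finally show ?thesis .
        qed
        let ?y = "s *\<^sub>R a + h *\<^sub>R b" and ?z = "s *\<^sub>R a"
        have na: "norm a \<le> norm v + norm w" using ab norm_ge_zero[of b] by linarith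
        have "f' (x + s *\<^sub>R a + h *\<^sub>R b) - f' (x + s *\<^sub>R a) - h *\<^sub>R f'' b
            = (f' (x + ?y) - f' x - f'' ?y) - (f' (x + ?z) - f' x - f'' ?z)"
          by (simp add: f''.add f''.scaleR add.assoc)
        then have "norm (f' (x + s *\<^sub>R a + h *\<^sub>R b) - f' (x + s *\<^sub>R a) - h *\<^sub>R f'' b)
            \<le> norm (f' (x + ?y) - f' x - f'' ?y) + norm (f' (x + ?z) - f' x - f'' ?z)"
          by (simp only: norm_triangle_ineq4)
        also have "\<dots> \<le> e * (h * (norm v + norm w)) + e * (h * (norm v + norm w))"
          using len[OF s, of h] len[OF s, of 0] h by (intro add_mono est) auto
        finally have "norm (\<phi>' s) \<le> (e * (h * (norm v + norm w)) + e * (h * (norm v + norm w))) * norm a"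
          unfolding \<phi>'_def by (intro order_trans[OF norm_blinfun] mult_right_mono) auto
        also have "(e * (h * (norm v + norm w)) + e * (h * (norm v + norm w))) * norm a
            \<le> (e * (h * (norm v + norm w)) + e * (h * (norm v + norm w))) * (norm v + norm w)"
          by (intro mult_left_mono na) (use e h in auto)
        finally show ?thesis by (simp add: M_def algebra_simps)
      qed
      have "norm (\<phi> h - \<phi> 0) \<le> (e * M * h) * norm (h - 0)"
      proof (rule differentiable_bound[of "{0..h}" \<phi> "\<lambda>s t. t *\<^sub>R \<phi>' s"])
        show "onorm (\<lambda>t. t *\<^sub>R \<phi>' s) \<le> e * M * h" if "s \<in> {0..h}" for s
          by (rule onorm_le) (use mult_left_mono[OF norm\<phi>'[OF that]] in \<open>simp add: mult.commute\<close>)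
      qed (use der h in auto)
      moreover have "\<phi> h - \<phi> 0 = \<Delta>' - (h * h) *\<^sub>R blinfun_apply (f'' b) a"
        by (simp add: \<phi>_def \<Delta>')
      ultimately show ?thesis using h by (simp add: mult.assoc)
    qed
    have 1: "norm (\<Delta> - (h * h) *\<^sub>R blinfun_apply (f'' w) v) \<le> e * M * (h * h)"
      by (rule half) (simp_all add: \<Delta>_def)
    have 2: "norm (\<Delta> - (h * h) *\<^sub>R blinfun_apply (f'' v) w) \<le> e * M * (h * h)"
      by (rule half) (simp_all add: \<Delta>_def add_ac)
    have "(h * h) * norm (blinfun_apply (f'' v) w - blinfun_apply (f'' w) v)
        = norm ((\<Delta> - (h * h) *\<^sub>R blinfun_apply (f'' w) v) - (\<Delta> - (h * h) *\<^sub>R blinfun_apply (f'' v) w))"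
      using h by (simp flip: scaleR_diff_right)
    also have "\<dots> \<le> (h * h) * (2 * (e * M))"
      using norm_triangle_ineq4[of "\<Delta> - (h * h) *\<^sub>R blinfun_apply (f'' w) v" "\<Delta> - (h * h) *\<^sub>R blinfun_apply (f'' v) w"] 1 2
      by (simp add: algebra_simps)
    finally show ?thesis using h by simp
  qed
  have "norm (blinfun_apply (f'' v) w - blinfun_apply (f'' w) v) \<le> 0"
  proof (rule field_le_epsilon)
    fix e :: real assume e: "e > 0"
    have "2 * (e / (2 * M + 1) * M) \<le> e"
      using e M by (simp add: field_simps)
    then show "norm (blinfun_apply (f'' v) w - blinfun_apply (f'' w) v) \<le> 0 + e"
      using bound[of "e / (2 * M + 1)"] e M by simp
  qed
  then show ?thesis by simp
qed

text \<open>
  The primitive is the integral of \<open>\<omega>\<close> over the segment from a base point \<open>a\<close> to \<open>x\<close>. Differentiating under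
  the integral sign, closedness turns the integrand of the derivative into the \<open>t\<close>-derivative of
  \<open>t \<omega>(a + t (x - a))\<close>, which integrates to \<open>\<omega>(x)\<close>.
\<close>
lemma poincare_convex:
  fixes \<omega> :: "'a::banach \<Rightarrow> 'a \<Rightarrow>\<^sub>L 'b::banach"
  assumes U: "open U" "convex U"
    and \<omega>': "\<And>x. x \<in> U \<Longrightarrow> (\<omega> has_derivative blinfun_apply (\<omega>' x)) (at x)"
    and cont: "continuous_on U \<omega>'"
    and closed: "\<And>x v w. x \<in> U \<Longrightarrow> blinfun_apply (blinfun_apply (\<omega>' x) v) w = blinfun_apply (blinfun_apply (\<omega>' x) w) v"
  obtains f where "\<And>x. x \<in> U \<Longrightarrow> (f has_derivative blinfun_apply (\<omega> x)) (at x)"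
proof (cases "U = {}")
  case False
  then obtain a where a: "a \<in> U" by blast
  define \<gamma> where "\<gamma> x t = a + t *\<^sub>R (x - a)" for x and t :: real
  define F where "F x t = \<omega> (\<gamma> x t) (x - a)" for x t
  define F' where "F' x t = \<omega> (\<gamma> x t) + t *\<^sub>R \<omega>' (\<gamma> x t) (x - a)" for x t
  have \<gamma>: "\<gamma> x t \<in> U" if "x \<in> U" "t \<in> cbox 0 1" for x t
  proof -
    have "\<gamma> x t = (1 - t) *\<^sub>R a + t *\<^sub>R x" by (simp add: \<gamma>_def algebra_simps)
    then show ?thesis using convexD_alt[OF U(2) a that(1), of t] that(2) by simp
  qed
  have cont\<omega>: "continuous_on U \<omega>"
    using \<omega>' by (auto intro!: continuous_at_imp_continuous_on has_derivative_continuous)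
  have \<gamma>cont: "continuous_on (U \<times> cbox 0 1) (\<lambda>z. \<gamma> (fst z) (snd z))"
    unfolding \<gamma>_def by (intro continuous_intros)
  have derF: "((\<lambda>x. F x t) has_derivative blinfun_apply (F' x t)) (at x within U)"
    if x: "x \<in> U" and t: "t \<in> cbox 0 1" for x t
  proof -
    have "((\<lambda>x. \<gamma> x t) has_derivative (\<lambda>v. t *\<^sub>R v)) (at x within U)"
      unfolding \<gamma>_def by (auto intro!: derivative_eq_intros)
    from has_derivative_compose[OF this \<omega>'[OF \<gamma>[OF x t]]]
    have 1: "((\<lambda>x. \<omega> (\<gamma> x t)) has_derivative (\<lambda>v. \<omega>' (\<gamma> x t) (t *\<^sub>R v))) (at x within U)" .
    have "((\<lambda>x. x - a) has_derivative (\<lambda>v. v)) (at x within U)"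
      by (auto intro!: derivative_eq_intros)
    from blinfun.FDERIV[OF 1 this]
    have "((\<lambda>x. F x t) has_derivative (\<lambda>v. \<omega> (\<gamma> x t) v + \<omega>' (\<gamma> x t) (t *\<^sub>R v) (x - a))) (at x within U)"
      unfolding F_def .
    then show ?thesis
      by (rule has_derivative_eq_rhs)
        (simp add: F'_def fun_eq_iff blinfun.scaleR_left blinfun.scaleR_right blinfun.add_left closed[OF \<gamma>[OF x t], of _ "x - a"])
  qed
  have contF': "continuous_on (U \<times> cbox 0 1) (\<lambda>(x, t). F' x t)"
    unfolding F'_def split_beta
    by (intro continuous_intros continuous_on_compose2[OF cont \<gamma>cont] continuous_on_compose2[OF cont\<omega> \<gamma>cont])
      (auto intro!: \<gamma>[simplified])
  have intF: "F x integrable_on cbox 0 1" if x: "x \<in> U" for x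
  proof (rule integrable_continuous)
    have "continuous_on (cbox 0 1) (\<gamma> x)" unfolding \<gamma>_def by (intro continuous_intros)
    then show "continuous_on (cbox 0 1) (F x)"
      unfolding F_def using \<gamma>[OF x]
      by (intro continuous_intros continuous_on_compose2[OF cont\<omega>]) auto
  qed
  have FTC: "integral (cbox 0 1) (F' x) = \<omega> x" if x: "x \<in> U" for x
  proof -
    have "((\<lambda>t. t *\<^sub>R \<omega> (\<gamma> x t)) has_vector_derivative F' x t) (at t within {0..1})" if t: "t \<in> {0..1}" for t
    proof -
      have "(\<gamma> x has_derivative (\<lambda>s. s *\<^sub>R (x - a))) (at t within {0..1})"
        unfolding \<gamma>_def by (auto intro!: derivative_eq_intros)
      from has_derivative_compose[OF this \<omega>'[OF \<gamma>[OF x]]] t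
      have "((\<lambda>t. \<omega> (\<gamma> x t)) has_derivative (\<lambda>s. \<omega>' (\<gamma> x t) (s *\<^sub>R (x - a)))) (at t within {0..1})" by simp
      from has_derivative_scaleR[OF has_derivative_ident this]
      show ?thesis
        unfolding has_vector_derivative_def
        by (rule has_derivative_eq_rhs) (simp add: F'_def fun_eq_iff blinfun.bilinear_simps algebra_simps)
    qed
    then have "(F' x has_integral 1 *\<^sub>R \<omega> (\<gamma> x 1) - 0 *\<^sub>R \<omega> (\<gamma> x 0)) {0..1}"
      by (intro fundamental_theorem_of_calculus) auto
    then show ?thesis by (simp add: integral_unique \<gamma>_def)
  qed
  have "((\<lambda>x. integral (cbox 0 1) (F x)) has_derivative blinfun_apply (\<omega> x)) (at x)" if x: "x \<in> U" for x
    using leibniz_rule[OF derF intF contF' x U(2)] FTC[OF x] at_within_open[OF x U(1)] by simp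
  then show ?thesis by (rule that)
qed (use that in auto)

section \<open>Continuation of local sections\<close>

text \<open>
  The setting of the monodromy argument: functions on open sets that cover the space, any two of which
  differ by a constant near each common point. Local primitives of a closed form are of this kind.
\<close>
locale local_sections =
  fixes S :: "('g::topological_space set \<times> ('g \<Rightarrow> 'e::ab_group_add)) set"
  assumes section_open: "(U, f) \<in> S \<Longrightarrow> open U"
    and section_path_connected: "(U, f) \<in> S \<Longrightarrow> path_connected U"
    and section_cover: "\<exists>U f. (U, f) \<in> S \<and> p \<in> U"
    and section_compatible: "(U, f) \<in> S \<Longrightarrow> (V, g) \<in> S \<Longrightarrow> p \<in> U \<Longrightarrow> p \<in> V \<Longrightarrow>
      \<exists>W k. open W \<and> p \<in> W \<and> (\<forall>q\<in>W. f q = g q + k)"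
begin

text \<open>
  \<open>F\<close> continues the sections along \<open>h\<close>: near each point of \<open>K\<close> it is the pullback by \<open>h\<close> of a section, up
  to a constant. For a path \<open>h\<close> this is analytic continuation; for a homotopy \<open>h\<close> it is a family of
  continuations along all its paths at once.
\<close>
definition continuation :: "('b::topological_space \<Rightarrow> 'g) \<Rightarrow> 'b set \<Rightarrow> ('b \<Rightarrow> 'e) \<Rightarrow> bool" where
  "continuation h K F \<longleftrightarrow> (\<forall>z\<in>K. \<exists>U f k N. (U, f) \<in> S \<and> open N \<and> z \<in> N \<and>
    (\<forall>w\<in>N \<inter> K. h w \<in> U \<and> F w = f (h w) + k))"

lemma continuationE:
  assumes "continuation h K F" "z \<in> K"
  obtains U f k N where "(U, f) \<in> S" "open N" "z \<in> N"
    "\<And>w. w \<in> N \<Longrightarrow> w \<in> K \<Longrightarrow> h w \<in> U" "\<And>w. w \<in> N \<Longrightarrow> w \<in> K \<Longrightarrow> F w = f (h w) + k"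
  using assms unfolding continuation_def by (metis IntI)

lemma continuation_in_section:
  assumes "(U, f) \<in> S" "h ` K \<subseteq> U"
  shows "continuation h K (\<lambda>z. f (h z))"
  unfolding continuation_def
proof
  fix z assume "z \<in> K"
  then show "\<exists>V g k N. (V, g) \<in> S \<and> open N \<and> z \<in> N \<and>
      (\<forall>w\<in>N \<inter> K. h w \<in> V \<and> f (h w) = g (h w) + k)"
    using assms by (intro exI[of _ U] exI[of _ f] exI[of _ 0] exI[of _ UNIV]) auto
qed

lemma continuation_cong:
  assumes "continuation h K F" "\<And>z. z \<in> K \<Longrightarrow> h' z = h z" "\<And>z. z \<in> K \<Longrightarrow> F' z = F z"
  shows "continuation h' K F'"
  unfolding continuation_def
proof
  fix z assume "z \<in> K"
  with assms(1) obtain U f k N where *: "(U, f) \<in> S" "open N" "z \<in> N"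
    "\<And>w. w \<in> N \<Longrightarrow> w \<in> K \<Longrightarrow> h w \<in> U" "\<And>w. w \<in> N \<Longrightarrow> w \<in> K \<Longrightarrow> F w = f (h w) + k"
    by (rule continuationE) blast
  then show "\<exists>V g k N. (V, g) \<in> S \<and> open N \<and> z \<in> N \<and>
      (\<forall>w\<in>N \<inter> K. h' w \<in> V \<and> F' w = g (h' w) + k)"
    using assms(2,3) by (intro exI[of _ U] exI[of _ f] exI[of _ k] exI[of _ N]) simp
qed

lemma continuation_shift:
  assumes "continuation h K F"
  shows "continuation h K (\<lambda>z. F z + c)"
  unfolding continuation_def
proof
  fix z assume "z \<in> K"
  with assms(1) obtain U f k N where *: "(U, f) \<in> S" "open N" "z \<in> N"
    "\<And>w. w \<in> N \<Longrightarrow> w \<in> K \<Longrightarrow> h w \<in> U" "\<And>w. w \<in> N \<Longrightarrow> w \<in> K \<Longrightarrow> F w = f (h w) + k"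
    by (rule continuationE) blast
  then show "\<exists>V g k N. (V, g) \<in> S \<and> open N \<and> z \<in> N \<and>
      (\<forall>w\<in>N \<inter> K. h w \<in> V \<and> F w + c = g (h w) + k)"
    by (intro exI[of _ U] exI[of _ f] exI[of _ "k + c"] exI[of _ N]) (simp add: add.assoc)
qed

lemma continuation_compose:
  assumes F: "continuation h K F" and \<phi>: "continuous_on K' \<phi>" "\<phi> ` K' \<subseteq> K"
  shows "continuation (\<lambda>t. h (\<phi> t)) K' (\<lambda>t. F (\<phi> t))"
  unfolding continuation_def
proof
  fix t assume t: "t \<in> K'"
  then have "\<phi> t \<in> K" using \<phi> by blast
  with F obtain U f k N where *: "(U, f) \<in> S" "open N" "\<phi> t \<in> N"
    "\<And>w. w \<in> N \<Longrightarrow> w \<in> K \<Longrightarrow> h w \<in> U" "\<And>w. w \<in> N \<Longrightarrow> w \<in> K \<Longrightarrow> F w = f (h w) + k"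
    by (rule continuationE) blast
  obtain M where M: "open M" "M \<inter> K' = \<phi> -` N \<inter> K'"
    using \<phi>(1) \<open>open N\<close> by (meson continuous_on_open_invariant)
  then have "t \<in> M" using t *(3) by blast
  moreover have "h (\<phi> w) \<in> U \<and> F (\<phi> w) = f (h (\<phi> w)) + k" if "w \<in> M \<inter> K'" for w
  proof -
    have "\<phi> w \<in> N" "\<phi> w \<in> K" using that M \<phi> by blast+
    then show ?thesis using * by blast
  qed
  ultimately show "\<exists>V g k M. (V, g) \<in> S \<and> open M \<and> t \<in> M \<and>
      (\<forall>w\<in>M \<inter> K'. h (\<phi> w) \<in> V \<and> F (\<phi> w) = g (h (\<phi> w)) + k)"
    using *(1) M(1) by blast
qed

lemma continuation_subset:
  "continuation h K F \<Longrightarrow> K' \<subseteq> K \<Longrightarrow> continuation h K' F"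
  using continuation_compose[of h K F K' "\<lambda>t. t"] by (simp add: image_subset_iff subset_iff)

lemma sections_differ_locally:
  assumes "(U, f) \<in> S" "(V, g) \<in> S" "continuous_on K h" "z \<in> K" "h z \<in> U" "h z \<in> V"
  obtains N k where "open N" "z \<in> N" "\<And>w. w \<in> N \<Longrightarrow> w \<in> K \<Longrightarrow> f (h w) = g (h w) + k"
proof -
  obtain W k where W: "open W" "h z \<in> W" "\<forall>q\<in>W. f q = g q + k"
    using section_compatible[OF assms(1,2,5,6)] by blast
  obtain N where N: "open N" "N \<inter> K = h -` W \<inter> K"
    using assms(3) \<open>open W\<close> by (meson continuous_on_open_invariant)
  show ?thesis
    by (rule that[of N k]) (use N W assms(4) in blast)+
qed

lemma continuation_unique:
  assumes K: "connected K" and h: "continuous_on K h"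
    and F: "continuation h K F" and G: "continuation h K G" and zw: "z \<in> K" "w \<in> K"
  shows "F z - G z = F w - G w"
proof (rule connected_local_const[OF K zw, where f = "\<lambda>x. F x - G x"], intro ballI)
  fix z assume z: "z \<in> K"
  obtain U f k M where 1: "(U, f) \<in> S" "open M" "z \<in> M"
    "\<And>w. w \<in> M \<Longrightarrow> w \<in> K \<Longrightarrow> h w \<in> U" "\<And>w. w \<in> M \<Longrightarrow> w \<in> K \<Longrightarrow> F w = f (h w) + k"
    using F z by (rule continuationE) blast
  obtain V g l N where 2: "(V, g) \<in> S" "open N" "z \<in> N"
    "\<And>w. w \<in> N \<Longrightarrow> w \<in> K \<Longrightarrow> h w \<in> V" "\<And>w. w \<in> N \<Longrightarrow> w \<in> K \<Longrightarrow> G w = g (h w) + l"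
    using G z by (rule continuationE) blast
  obtain W m where 3: "open W" "z \<in> W" "\<And>w. w \<in> W \<Longrightarrow> w \<in> K \<Longrightarrow> f (h w) = g (h w) + m"
    using sections_differ_locally[OF 1(1) 2(1) h z] 1 2 z by metis
  have "F w - G w = m + k - l" if "w \<in> M \<inter> N \<inter> W" "w \<in> K" for w
    using that 1(5) 2(5) 3(3) by simp
  then show "eventually (\<lambda>w. F z - G z = F w - G w) (at z within K)"
    unfolding eventually_at_topological
    using 1(2,3) 2(2,3) 3(1,2) z by (intro exI[of _ "M \<inter> N \<inter> W"]) auto
qed

text \<open>
  On the connected intersection the two continuations differ by a constant, so a shift makes them agree.
\<close>
lemma continuation_glue:
  assumes K: "closed K" "closed L" "connected (K \<inter> L)" "K \<inter> L \<noteq> {}"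
    and h: "continuous_on (K \<union> L) h"
    and F: "continuation h K F" and G: "continuation h L G"
  shows "\<exists>H. continuation h (K \<union> L) H"
proof -
  obtain a where a: "a \<in> K" "a \<in> L" using K(4) by blast
  define G' where "G' = (\<lambda>z. G z + (F a - G a))"
  have G': "continuation h L G'"
    unfolding G'_def using G by (rule continuation_shift)
  have eq: "F z = G' z" if "z \<in> K" "z \<in> L" for z
  proof -
    have "F z - G' z = F a - G' a"
      by (rule continuation_unique[OF K(3), of h])
        (use that a F G' h in \<open>auto intro: continuation_subset continuous_on_subset\<close>)
    then show ?thesis by (simp add: G'_def)
  qed
  define H where "H z = (if z \<in> K then F z else G' z)" for z
  have HK: "H z = F z" if "z \<in> K" for z using that by (simp add: H_def)
  have HL: "H z = G' z" if "z \<in> L" for z using that by (simp add: H_def eq)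
  have cl: "open (- K)" "open (- L)" using K by auto
  have "continuation h (K \<union> L) H"
    unfolding continuation_def
  proof
    fix z assume z: "z \<in> K \<union> L"
    consider "z \<in> K" "z \<notin> L" | "z \<in> L" "z \<notin> K" | "z \<in> K" "z \<in> L" using z by blast
    then show "\<exists>U f k N. (U, f) \<in> S \<and> open N \<and> z \<in> N \<and>
      (\<forall>w\<in>N \<inter> (K \<union> L). h w \<in> U \<and> H w = f (h w) + k)"
    proof cases
      case 1
      obtain U f k N where *: "(U, f) \<in> S" "open N" "z \<in> N"
        "\<And>w. w \<in> N \<Longrightarrow> w \<in> K \<Longrightarrow> h w \<in> U" "\<And>w. w \<in> N \<Longrightarrow> w \<in> K \<Longrightarrow> F w = f (h w) + k"
        using F 1(1) by (rule continuationE) blast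
      then show ?thesis
        using 1 cl HK by (intro exI[of _ U] exI[of _ f] exI[of _ k] exI[of _ "N \<inter> - L"]) auto
    next
      case 2
      obtain U f k N where *: "(U, f) \<in> S" "open N" "z \<in> N"
        "\<And>w. w \<in> N \<Longrightarrow> w \<in> L \<Longrightarrow> h w \<in> U" "\<And>w. w \<in> N \<Longrightarrow> w \<in> L \<Longrightarrow> G' w = f (h w) + k"
        using G' 2(1) by (rule continuationE) blast
      then show ?thesis
        using 2 cl HL by (intro exI[of _ U] exI[of _ f] exI[of _ k] exI[of _ "N \<inter> - K"]) auto
    next
      case 3
      obtain U f k M where 1: "(U, f) \<in> S" "open M" "z \<in> M"
        "\<And>w. w \<in> M \<Longrightarrow> w \<in> K \<Longrightarrow> h w \<in> U" "\<And>w. w \<in> M \<Longrightarrow> w \<in> K \<Longrightarrow> F w = f (h w) + k"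
        using F 3(1) by (rule continuationE) blast
      obtain V g l N where 2: "(V, g) \<in> S" "open N" "z \<in> N"
        "\<And>w. w \<in> N \<Longrightarrow> w \<in> L \<Longrightarrow> h w \<in> V" "\<And>w. w \<in> N \<Longrightarrow> w \<in> L \<Longrightarrow> G' w = g (h w) + l"
        using G' 3(2) by (rule continuationE) blast
      obtain W m where W: "open W" "z \<in> W"
        "\<And>w. w \<in> W \<Longrightarrow> w \<in> K \<union> L \<Longrightarrow> f (h w) = g (h w) + m"
        using sections_differ_locally[OF 1(1) 2(1) h z] 1 2 3 by metis
      have hU: "open U" using 1 section_open by blast
      obtain W' where W': "open W'" "W' \<inter> (K \<union> L) = h -` U \<inter> (K \<union> L)"
        using h hU by (meson continuous_on_open_invariant)
      \<comment> \<open>Both pieces take the same value at \<open>z\<close>, which fixes the offset between their constants.\<close>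
      have "f (h z) + k = g (h z) + l" using 1 2 3 eq by metis
      then have l: "l = m + k" using W(3)[OF W(2) z] by simp
      have "h w \<in> U \<and> H w = f (h w) + k" if w: "w \<in> M \<inter> N \<inter> W \<inter> W'" "w \<in> K \<union> L" for w
      proof (cases "w \<in> K")
        case True
        then show ?thesis using w 1 HK by simp
      next
        case False
        then have "w \<in> L" using w by simp
        moreover have "h w \<in> U" using w W' by blast
        ultimately show ?thesis using w 2 HL W(3) l by simp
      qed
      moreover have "z \<in> W'" using W' z 1 3 by blast
      ultimately show ?thesis
        using 1 2 W(1,2) W'(1)
        by (intro exI[of _ U] exI[of _ f] exI[of _ k] exI[of _ "M \<inter> N \<inter> W \<inter> W'"]) auto
    qed
  qed
  then show ?thesis by blast
qed

lemma continuation_local: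
  assumes h: "continuous_on K h" and z: "z \<in> K"
  obtains N F where "open N" "z \<in> N" "continuation h (N \<inter> K) F"
proof -
  obtain U f where U: "(U, f) \<in> S" "h z \<in> U" using section_cover by blast
  obtain N where N: "open N" "N \<inter> K = h -` U \<inter> K"
    using h section_open[OF U(1)] by (meson continuous_on_open_invariant)
  have "continuation h (N \<inter> K) (\<lambda>z. f (h z))"
    by (rule continuation_in_section[OF U(1)]) (use N in blast)
  then show ?thesis using that N U z by blast
qed

text \<open>
  Continuations exist near each point. Gluing in the second coordinate gives continuations on thin strips
  over the whole of \<open>{c..d}\<close>, and gluing these strips in the first coordinate gives the rectangle. In both
  passes the pieces meet in a segment, which is connected.
\<close>
lemma continuation_rectangle:
  fixes h :: "real \<times> real \<Rightarrow> 'g"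
  assumes h: "continuous_on ({a..b} \<times> {c..d}) h" and ab: "a \<le> b" and cd: "c \<le> d"
  shows "\<exists>F. continuation h ({a..b} \<times> {c..d}) F"
proof -
  let ?K = "\<lambda>x \<delta> p q. ({x - \<delta>..x + \<delta>} \<inter> {a..b}) \<times> {p..q}"
  have strip: "\<exists>\<delta>>0. \<exists>F. continuation h (?K x \<delta> c d) F" if x: "a \<le> x" "x \<le> b" for x
  proof -
    define Q where "Q p q \<longleftrightarrow> (c \<le> p \<and> q \<le> d \<longrightarrow> (\<exists>\<delta>>0. \<exists>F. continuation h (?K x \<delta> p q) F))" for p q
    have "Q c d"
      using cd
    proof (induction rule: Bolzano)
      case (trans p q r)
      show ?case
        unfolding Q_def
      proof
        assume pr: "c \<le> p \<and> r \<le> d"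
        obtain \<delta> F where 1: "\<delta> > 0" "continuation h (?K x \<delta> p q) F"
          using trans pr unfolding Q_def by force
        obtain \<epsilon> G where 2: "\<epsilon> > 0" "continuation h (?K x \<epsilon> q r) G"
          using trans pr unfolding Q_def by force
        define \<eta> where "\<eta> = min \<delta> \<epsilon>"
        have eq: "?K x \<eta> p q \<union> ?K x \<eta> q r = ?K x \<eta> p r"
          using trans(3,4) by auto
        have int: "?K x \<eta> p q \<inter> ?K x \<eta> q r = ({x - \<eta>..x + \<eta>} \<inter> {a..b}) \<times> {q}"
          using trans(3,4) by auto
        have "\<exists>H. continuation h (?K x \<eta> p q \<union> ?K x \<eta> q r) H"
        proof (rule continuation_glue)
          show "connected (?K x \<eta> p q \<inter> ?K x \<eta> q r)"
            unfolding int by (intro connected_Times) (auto simp: Int_atLeastAtMost)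
          show "?K x \<eta> p q \<inter> ?K x \<eta> q r \<noteq> {}"
            unfolding int using x 1 2 by (auto simp: \<eta>_def intro!: exI[of _ x])
          show "continuous_on (?K x \<eta> p q \<union> ?K x \<eta> q r) h"
            unfolding eq by (rule continuous_on_subset[OF h]) (use pr in auto)
          show "continuation h (?K x \<eta> p q) F"
            by (rule continuation_subset[OF 1(2)]) (auto simp: \<eta>_def)
          show "continuation h (?K x \<eta> q r) G"
            by (rule continuation_subset[OF 2(2)]) (auto simp: \<eta>_def)
        qed (intro closed_Times closed_Int; simp)+
        moreover have "\<eta> > 0" using 1 2 by (simp add: \<eta>_def)
        ultimately show "\<exists>\<delta>>0. \<exists>F. continuation h (?K x \<delta> p r) F"
          unfolding eq by blast
      qed
    next
      case (local y)
      obtain N F where N: "open N" "(x, y) \<in> N" "continuation h (N \<inter> ({a..b} \<times> {c..d})) F"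
        using continuation_local[OF h, of "(x, y)"] x local by auto
      obtain A B where AB: "open A" "open B" "x \<in> A" "y \<in> B" "A \<times> B \<subseteq> N"
        using open_prod_elim[OF N(1,2)] by (metis mem_Sigma_iff)
      obtain \<delta> where \<delta>: "\<delta> > 0" "cball x \<delta> \<subseteq> A" using AB open_contains_cball by blast
      obtain \<epsilon> where \<epsilon>: "\<epsilon> > 0" "cball y \<epsilon> \<subseteq> B" using AB open_contains_cball by blast
      have "Q p q" if "p \<le> y \<and> y \<le> q \<and> q - p < \<epsilon>" for p q
        unfolding Q_def
      proof
        assume "c \<le> p \<and> q \<le> d"
        moreover have "{p..q} \<subseteq> cball y \<epsilon>" using that by (auto simp: dist_real_def)
        moreover have "{x - \<delta>..x + \<delta>} \<subseteq> A" using \<delta> by (auto simp: cball_eq_atLeastAtMost)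
        ultimately have "?K x \<delta> p q \<subseteq> N \<inter> ({a..b} \<times> {c..d})"
          using \<epsilon> AB by fastforce
        then show "\<exists>\<delta>>0. \<exists>F. continuation h (?K x \<delta> p q) F"
          using \<delta>(1) N(3) continuation_subset by blast
      qed
      then show ?case using \<epsilon>(1) by blast
    qed
    then show ?thesis by (simp add: Q_def)
  qed
  define P where "P p q \<longleftrightarrow> (a \<le> p \<and> q \<le> b \<longrightarrow> (\<exists>F. continuation h ({p..q} \<times> {c..d}) F))" for p q
  have "P a b"
    using ab
  proof (induction rule: Bolzano)
    case (trans p q r)
    show ?case
      unfolding P_def
    proof
      assume pr: "a \<le> p \<and> r \<le> b"
      obtain F where 1: "continuation h ({p..q} \<times> {c..d}) F" using trans pr unfolding P_def by force
      obtain G where 2: "continuation h ({q..r} \<times> {c..d}) G" using trans pr unfolding P_def by force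
      have eq: "{p..q} \<times> {c..d} \<union> {q..r} \<times> {c..d} = {p..r} \<times> {c..d}" using trans(3,4) by auto
      have int: "{p..q} \<times> {c..d} \<inter> {q..r} \<times> {c..d} = {q} \<times> {c..d}" using trans(3,4) by auto
      have "\<exists>H. continuation h ({p..q} \<times> {c..d} \<union> {q..r} \<times> {c..d}) H"
      proof (rule continuation_glue[OF _ _ _ _ _ 1 2])
        show "connected ({p..q} \<times> {c..d} \<inter> {q..r} \<times> {c..d})"
          unfolding int by (intro connected_Times) auto
        show "{p..q} \<times> {c..d} \<inter> {q..r} \<times> {c..d} \<noteq> {}" unfolding int using cd by auto
        show "continuous_on ({p..q} \<times> {c..d} \<union> {q..r} \<times> {c..d}) h"
          unfolding eq by (rule continuous_on_subset[OF h]) (use pr in auto)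
      qed (intro closed_Times; simp)+
      then show "\<exists>F. continuation h ({p..r} \<times> {c..d}) F" unfolding eq .
    qed
  next
    case (local x)
    then obtain \<delta> F where \<delta>: "\<delta> > 0" "continuation h (?K x \<delta> c d) F" using strip by blast
    have "P p q" if "p \<le> x \<and> x \<le> q \<and> q - p < \<delta>" for p q
      unfolding P_def
    proof
      assume "a \<le> p \<and> q \<le> b"
      then have "{p..q} \<times> {c..d} \<subseteq> ?K x \<delta> c d" using that by auto
      then show "\<exists>F. continuation h ({p..q} \<times> {c..d}) F"
        using \<delta>(2) continuation_subset by blast
    qed
    then show ?case using \<delta>(1) by blast
  qed
  then show ?thesis by (simp add: P_def)
qed

lemma continuation_path:
  assumes "path \<gamma>"
  obtains F where "continuation \<gamma> {0..1} F"
proof -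
  have "continuous_on ({0..0} \<times> {0..1}) (\<lambda>z::real \<times> real. \<gamma> (snd z))"
    using assms unfolding path_def
    by (auto intro!: continuous_on_compose2[of "{0..1}" \<gamma>] continuous_intros)
  then obtain F where "continuation (\<lambda>z::real \<times> real. \<gamma> (snd z)) ({0..0} \<times> {0..1}) F"
    using continuation_rectangle[of 0 0 0 1] by fastforce
  then have "continuation (\<lambda>t. \<gamma> (snd (0 :: real, t))) {0..1} (\<lambda>t. F (0, t))"
    by (rule continuation_compose) (auto intro!: continuous_intros)
  then show ?thesis using that by simp
qed

text \<open>
  The change along \<open>\<gamma>\<close> of a continuation: the integral over \<open>\<gamma>\<close> if the sections are primitives of a
  form. Every continuation along \<open>\<gamma>\<close> gives the same value.
\<close>
definition increment :: "(real \<Rightarrow> 'g) \<Rightarrow> 'e" where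
  "increment \<gamma> = (let F = SOME F. continuation \<gamma> {0..1} F in F 1 - F 0)"

lemma increment_eq:
  assumes "path \<gamma>" "continuation \<gamma> {0..1} F"
  shows "increment \<gamma> = F 1 - F 0"
proof -
  define G where "G = (SOME F. continuation \<gamma> {0..1} F)"
  have "continuation \<gamma> {0..1} G" unfolding G_def using assms(2) by (rule someI[of "continuation \<gamma> {0..1}"])
  then have "F 1 - G 1 = F 0 - G 0"
    using assms by (intro continuation_unique[of "{0..1}" \<gamma>]) (auto simp: path_def)
  then show ?thesis
    unfolding increment_def G_def[symmetric] by (simp add: algebra_simps)
qed

lemma increment_join:
  assumes "path p" "path q" "pathfinish p = pathstart q"
  shows "increment (p +++ q) = increment p + increment q"
proof -
  have pq: "path (p +++ q)" using assms by (simp add: path_join)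
  then obtain F where F: "continuation (p +++ q) {0..1} F" by (rule continuation_path)
  have "continuation (\<lambda>t. (p +++ q) (t / 2)) {0..1} (\<lambda>t. F (t / 2))"
    using F by (rule continuation_compose) (auto intro!: continuous_intros)
  then have "continuation p {0..1} (\<lambda>t. F (t / 2))"
    by (rule continuation_cong) (auto simp: joinpaths_def)
  moreover have "continuation (\<lambda>t. (p +++ q) ((t + 1) / 2)) {0..1} (\<lambda>t. F ((t + 1) / 2))"
    using F by (rule continuation_compose) (auto intro!: continuous_intros)
  then have "continuation q {0..1} (\<lambda>t. F ((t + 1) / 2))"
  proof (rule continuation_cong)
    fix t :: real assume "t \<in> {0..1}"
    then show "q t = (p +++ q) ((t + 1) / 2)"
      using assms(3) by (cases "t = 0") (auto simp: joinpaths_def pathfinish_def pathstart_def add_divide_distrib)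
  qed simp
  ultimately show ?thesis
    using increment_eq[OF pq F] increment_eq[OF assms(1)] increment_eq[OF assms(2)] by simp
qed

lemma increment_reversepath:
  assumes "path p"
  shows "increment (reversepath p) = - increment p"
proof -
  obtain F where F: "continuation p {0..1} F" using assms by (rule continuation_path)
  have "continuation (\<lambda>t. p (1 - t)) {0..1} (\<lambda>t. F (1 - t))"
    using F by (rule continuation_compose) (auto intro!: continuous_intros)
  then have "continuation (reversepath p) {0..1} (\<lambda>t. F (1 - t))"
    by (simp add: reversepath_def)
  then show ?thesis
    using increment_eq[OF assms F] increment_eq[of "reversepath p"] assms by simp
qed

text \<open>
  Let \<open>F\<close> be a continuation on a free homotopy of \<open>p\<close> to a constant loop. The two sides of the square
  traversed by the base point are mapped to the same path, so \<open>F\<close> differs on them by a constant: the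
  increment is the same for all loops of the homotopy, and it vanishes for the constant one.
\<close>
lemma increment_loop:
  assumes sc: "simply_connected (UNIV :: 'g set)" and p: "path p" "pathfinish p = pathstart p"
  shows "increment p = 0"
proof -
  define a where "a = p 0"
  have "homotopic_loops UNIV p (\<lambda>_. a)"
  proof -
    have "path (\<lambda>_::real. a)" by (simp add: path_def)
    then show ?thesis
      using sc p unfolding simply_connected_def by (simp add: pathfinish_def pathstart_def)
  qed
  then obtain h where h: "continuous_on ({0..1} \<times> {0..1}) h"
    "\<And>x. x \<in> {0..1} \<Longrightarrow> h (0, x) = p x" "\<And>x. x \<in> {0..1} \<Longrightarrow> h (1, x) = a"
    "\<And>t. t \<in> {0..1::real} \<Longrightarrow> h (t, 1) = h (t, 0 :: real)"
    unfolding homotopic_loops pathfinish_def pathstart_def by auto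
  obtain F where F: "continuation h ({0..1} \<times> {0..1}) F"
    using continuation_rectangle[OF h(1)] by auto
  have edge: "continuation (\<lambda>t. h (\<phi> t)) {0..1} (\<lambda>t. F (\<phi> t))"
    if "continuous_on {0..1} \<phi>" "\<phi> ` {0..1} \<subseteq> {0..1} \<times> {0..1}" for \<phi> :: "real \<Rightarrow> real \<times> real"
    using continuation_compose[OF F] that by blast
  have 0: "continuation (\<lambda>t. h (t, 0)) {0..1} (\<lambda>t. F (t, 0))"
    by (rule edge) (auto intro!: continuous_intros)
  have "continuation (\<lambda>t. h (t, 1)) {0..1} (\<lambda>t. F (t, 1))"
    by (rule edge) (auto intro!: continuous_intros)
  then have 1: "continuation (\<lambda>t. h (t, 0)) {0..1} (\<lambda>t. F (t, 1))"
    by (rule continuation_cong) (simp_all add: h(4))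
  have "continuous_on {0..1} (\<lambda>t. h (t, 0))"
    by (rule continuous_on_compose2[OF h(1)]) (auto intro!: continuous_intros)
  from continuation_unique[OF _ this 1 0]
  have sides: "F (0, 1) - F (0, 0) = F (1, 1) - F (1, 0)" by simp
  have "continuation (\<lambda>t. h (0, t)) {0..1} (\<lambda>t. F (0, t))"
    by (rule edge) (auto intro!: continuous_intros)
  then have left: "continuation p {0..1} (\<lambda>t. F (0, t))"
    by (rule continuation_cong) (simp_all add: h(2))
  have "continuation (\<lambda>t. h (1, t)) {0..1} (\<lambda>t. F (1, t))"
    by (rule edge) (auto intro!: continuous_intros)
  then have right: "continuation (\<lambda>_. a) {0..1} (\<lambda>t. F (1, t))"
    by (rule continuation_cong) (simp_all add: h(3))
  obtain U f where U: "(U, f) \<in> S" "a \<in> U" using section_cover by blast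
  have "continuation (\<lambda>_::real. a) {0..1} (\<lambda>_. f a)"
    by (rule continuation_in_section[OF U(1)]) (use U in auto)
  from continuation_unique[OF _ _ right this]
  have "F (1, 1) - f a = F (1, 0) - f a" by simp
  then show ?thesis using sides increment_eq[OF p(1) left] by simp
qed

text \<open>
  The global function is the increment along any path from a fixed point; loops having increment zero, the
  path does not matter. Within a path-connected section, paths can be prolonged inside the section, where
  the increment is that of the section itself.
\<close>
theorem global_section:
  assumes sc: "simply_connected (UNIV :: 'g set)"
  obtains \<theta> where "\<And>U f. (U, f) \<in> S \<Longrightarrow> \<exists>k. \<forall>q\<in>U. \<theta> q = f q + k"
proof -
  define a :: 'g where "a = undefined"
  have "\<exists>\<gamma>. path \<gamma> \<and> pathstart \<gamma> = a \<and> pathfinish \<gamma> = b" for b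
  proof -
    have "path (\<lambda>_::real. a)" "path (\<lambda>_::real. b)" by (simp_all add: path_def)
    then have "homotopic_loops UNIV (\<lambda>_. a) (\<lambda>_. b)"
      using sc unfolding simply_connected_def by (simp add: pathfinish_def pathstart_def)
    then obtain h where h: "continuous_on ({0..1::real} \<times> {0..1::real}) h"
      "\<And>x. x \<in> {0..1} \<Longrightarrow> h (0, x) = a" "\<And>x. x \<in> {0..1} \<Longrightarrow> h (1, x) = b"
      unfolding homotopic_loops by auto
    have "path (\<lambda>t. h (t, 0))"
      unfolding path_def by (rule continuous_on_compose2[OF h(1)]) (auto intro!: continuous_intros)
    then show ?thesis using h by (intro exI[of _ "\<lambda>t. h (t, 0)"]) (simp add: pathfinish_def pathstart_def)
  qed
  then obtain \<gamma> where \<gamma>: "\<And>b. path (\<gamma> b)" "\<And>b. pathstart (\<gamma> b) = a" "\<And>b. pathfinish (\<gamma> b) = b"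
    by metis
  define \<theta> where "\<theta> b = increment (\<gamma> b)" for b
  have "\<exists>k. \<forall>q\<in>U. \<theta> q = f q + k" if U: "(U, f) \<in> S" for U f
  proof (cases "U = {}")
    case False
    then obtain b where b: "b \<in> U" by blast
    have "\<theta> q = f q + (\<theta> b - f b)" if q: "q \<in> U" for q
    proof -
      obtain r where r: "path r" "path_image r \<subseteq> U" "pathstart r = b" "pathfinish r = q"
        using section_path_connected[OF U] b q unfolding path_connected_def by blast
      have "continuation r {0..1} (\<lambda>t. f (r t))"
        by (rule continuation_in_section[OF U]) (use r in \<open>simp add: path_image_def\<close>)
      then have "increment r = f q - f b"
        using increment_eq[OF r(1)] r by (simp add: pathfinish_def pathstart_def)
      moreover have "increment ((\<gamma> b +++ r) +++ reversepath (\<gamma> q)) = 0"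
        by (rule increment_loop[OF sc]) (simp_all add: \<gamma> r)
      then have "\<theta> b + increment r - \<theta> q = 0"
        by (simp add: increment_join increment_reversepath \<gamma> r \<theta>_def)
      ultimately have "\<theta> q = \<theta> b + (f q - f b)" by simp
      then show ?thesis by (metis add.commute add_diff_eq diff_add_eq)
    qed
    then show ?thesis by blast
  qed simp
  then show ?thesis by (rule that)
qed

end

section \<open>Maps on manifolds in charts\<close>

context smooth_manifold
begin

lemma charts_atD: "c \<in> charts_at A p \<Longrightarrow> c \<in> A" "c \<in> charts_at A p \<Longrightarrow> p \<in> fst c"
  by (auto simp: charts_at_def)

lemma ex_chart_at: "\<exists>c. c \<in> charts_at A p"
proof -
  have "p \<in> (\<Union>c\<in>A. fst c)" using covering by simp
  then show ?thesis unfolding charts_at_def by blast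
qed

lemma chart_inv_left: "c \<in> A \<Longrightarrow> p \<in> fst c \<Longrightarrow> chart_inv c (snd c p) = p"
  using chart_homeomorphism homeomorphism_apply1 by metis

lemma chart_inv_right: "c \<in> A \<Longrightarrow> x \<in> snd c ` fst c \<Longrightarrow> snd c (chart_inv c x) = x"
  using chart_homeomorphism homeomorphism_apply2 by metis

lemma chart_inv_in: "c \<in> A \<Longrightarrow> x \<in> snd c ` fst c \<Longrightarrow> chart_inv c x \<in> fst c"
  by (auto simp: chart_inv_left)

lemma charts_at_chart_inv: "c \<in> A \<Longrightarrow> x \<in> snd c ` fst c \<Longrightarrow> c \<in> charts_at A (chart_inv c x)"
  by (simp add: charts_at_def chart_inv_in)

lemma open_chart_image: "c \<in> A \<Longrightarrow> open U \<Longrightarrow> open (snd c ` (fst c \<inter> U))"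
proof -
  assume c: "c \<in> A" and U: "open U"
  have "snd c ` (fst c \<inter> U) = snd c ` fst c \<inter> chart_inv c -` U"
    using c by (auto simp: chart_inv_left)
  moreover have "open (snd c ` fst c \<inter> chart_inv c -` U)"
    using chart_homeomorphism[OF c] open_image[OF c] U
    by (auto simp: homeomorphism_def intro: continuous_open_preimage)
  ultimately show ?thesis by simp
qed

lemma open_chart_inv_image:
  assumes c: "c \<in> A" and N: "open N" "N \<subseteq> snd c ` fst c"
  shows "open (chart_inv c ` N)"
proof -
  have "chart_inv c ` N = fst c \<inter> snd c -` N"
    using c N by (auto simp: chart_inv_left chart_inv_right image_iff intro: chart_inv_in) (metis chart_inv_left)
  moreover have "open (fst c \<inter> snd c -` N)"
    using chart_homeomorphism[OF c] open_domain[OF c] N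
    by (auto simp: homeomorphism_def intro: continuous_open_preimage)
  ultimately show ?thesis by simp
qed

lemma has_derivative_chart_transform:
  assumes c: "c \<in> charts_at A p" and U: "open U" "p \<in> U"
    and f: "((\<lambda>x. f (chart_inv c x)) has_derivative D) (at (snd c p))"
    and eq: "\<And>q. q \<in> U \<Longrightarrow> q \<in> fst c \<Longrightarrow> f q = g q"
  shows "((\<lambda>x. g (chart_inv c x)) has_derivative D) (at (snd c p))"
proof (rule has_derivative_transform_within_open[OF f])
  show "open (snd c ` (fst c \<inter> U))" using c U charts_atD open_chart_image by blast
  show "snd c p \<in> snd c ` (fst c \<inter> U)" using c U charts_atD by blast
  show "f (chart_inv c x) = g (chart_inv c x)" if "x \<in> snd c ` (fst c \<inter> U)" for x
    using that eq charts_atD[OF c] by (auto simp: chart_inv_left)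
qed

lemma chart_chain_rule:
  assumes c: "c \<in> charts_at A p" and d: "d \<in> charts_at A (\<phi> p)" and \<phi>: "continuous_on UNIV \<phi>"
    and P: "((\<lambda>x. snd d (\<phi> (chart_inv c x))) has_derivative P) (at (snd c p))"
    and Q: "((\<lambda>y. f (chart_inv d y)) has_derivative Q) (at (snd d (\<phi> p)))"
  shows "((\<lambda>x. f (\<phi> (chart_inv c x))) has_derivative (\<lambda>v. Q (P v))) (at (snd c p))"
proof (rule has_derivative_chart_transform[OF c, where f = "\<lambda>q. f (chart_inv d (snd d (\<phi> q)))"])
  show "open (\<phi> -` fst d)" using \<phi> open_domain[OF charts_atD(1)[OF d]] by (simp add: continuous_on_open_vimage)
  show "p \<in> \<phi> -` fst d" using charts_atD(2)[OF d] by simp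
  have "chart_inv c (snd c p) = p" using c by (simp add: charts_atD chart_inv_left)
  then show "((\<lambda>x. f (chart_inv d (snd d (\<phi> (chart_inv c x))))) has_derivative (\<lambda>v. Q (P v))) (at (snd c p))"
    using has_derivative_compose[OF P, of "\<lambda>y. f (chart_inv d y)" Q] Q by simp
  show "f (chart_inv d (snd d (\<phi> q))) = f (\<phi> q)" if "q \<in> \<phi> -` fst d" for q
    using that charts_atD(1)[OF d] by (simp add: chart_inv_left)
qed

lemma smooth_map_chart:
  assumes f: "smooth_map A A f" and c: "c \<in> A" and d: "d \<in> A"
  shows "smooth_on (snd c ` (fst c \<inter> f -` fst d)) (\<lambda>x. snd d (f (chart_inv c x)))"
    and "open (snd c ` (fst c \<inter> f -` fst d))"
proof -
  show "smooth_on (snd c ` (fst c \<inter> f -` fst d)) (\<lambda>x. snd d (f (chart_inv c x)))"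
    using f c d unfolding smooth_map_def comp_def by blast
  show "open (snd c ` (fst c \<inter> f -` fst d))"
    using f open_domain[OF d] unfolding smooth_map_def
    by (intro open_chart_image c) (simp add: continuous_on_open_vimage)
qed

lemma smooth_map_chart_derivative:
  assumes f: "smooth_map A A f" and c: "c \<in> charts_at A p" and d: "d \<in> charts_at A (f p)"
  shows "((\<lambda>x. snd d (f (chart_inv c x))) has_derivative
    frechet_derivative (\<lambda>x. snd d (f (chart_inv c x))) (at (snd c p))) (at (snd c p))"
  using smooth_map_chart(1)[OF f charts_atD(1)[OF c] charts_atD(1)[OF d]]
  by (rule smooth_on_has_derivative) (use charts_atD c d in auto)

lemma smooth_map_vs_iff:
  "smooth_map A vs_atlas f \<longleftrightarrow>
    continuous_on UNIV f \<and> (\<forall>c\<in>A. smooth_on (snd c ` fst c) (\<lambda>x. f (chart_inv c x)))"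
  unfolding smooth_map_def vs_atlas_def by (simp add: comp_def id_def)

lemma smooth_map_vs_has_derivative:
  assumes "smooth_map A vs_atlas f" "c \<in> charts_at A p"
  shows "((\<lambda>x. f (chart_inv c x)) has_derivative
    frechet_derivative (\<lambda>x. f (chart_inv c x)) (at (snd c p))) (at (snd c p))"
  by (rule smooth_on_has_derivative[of "snd c ` fst c"])
    (use assms charts_atD in \<open>auto simp: smooth_map_vs_iff\<close>)

lemma equal_derivatives_imp_locally_constant_difference:
  assumes U: "open U" "p \<in> U"
    and D: "\<And>q c. q \<in> U \<Longrightarrow> c \<in> charts_at A q \<Longrightarrow> \<exists>D. ((\<lambda>x. f (chart_inv c x)) has_derivative D) (at (snd c q)) \<and>
      ((\<lambda>x. g (chart_inv c x)) has_derivative D) (at (snd c q))"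
  obtains W k where "open W" "p \<in> W" "\<And>q. q \<in> W \<Longrightarrow> f q = g q + k"
proof -
  obtain c where c: "c \<in> charts_at A p" using ex_chart_at by blast
  note cA = charts_atD(1)[OF c] and cp = charts_atD(2)[OF c]
  have "open (snd c ` (fst c \<inter> U))" "snd c p \<in> snd c ` (fst c \<inter> U)"
    using cA cp U open_chart_image by auto
  then obtain r where r: "r > 0" "ball (snd c p) r \<subseteq> snd c ` (fst c \<inter> U)"
    using open_contains_ball by blast
  let ?B = "ball (snd c p) r"
  have "((\<lambda>x. f (chart_inv c x) - g (chart_inv c x)) has_derivative (\<lambda>h. 0)) (at x within ?B)" if x: "x \<in> ?B" for x
  proof -
    obtain q where q: "q \<in> fst c" "q \<in> U" "x = snd c q" using x r by blast
    then have "c \<in> charts_at A q" using cA by (simp add: charts_at_def)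
    from D[OF q(2) this] obtain D where
      "((\<lambda>x. f (chart_inv c x)) has_derivative D) (at x)" "((\<lambda>x. g (chart_inv c x)) has_derivative D) (at x)"
      using q by auto
    from has_derivative_diff[OF this] show ?thesis
      by (simp add: has_derivative_at_withinI)
  qed
  from has_derivative_zero_constant[OF convex_ball this]
  obtain k where k: "\<And>x. x \<in> ?B \<Longrightarrow> f (chart_inv c x) - g (chart_inv c x) = k"
    by blast
  show ?thesis
  proof
    show "open (chart_inv c ` ?B)" by (rule open_chart_inv_image) (use cA r in auto)
    show "p \<in> chart_inv c ` ?B"
      using r by (intro image_eqI[of _ _ "snd c p"]) (simp_all add: chart_inv_left cA cp)
    show "f q = g q + k" if "q \<in> chart_inv c ` ?B" for q
      using that k by (auto simp: algebra_simps)
  qed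
qed

lemma equal_derivatives_imp_constant_difference:
  assumes "connected (UNIV :: 'p set)"
    and D: "\<And>q c. c \<in> charts_at A q \<Longrightarrow> \<exists>D. ((\<lambda>x. f (chart_inv c x)) has_derivative D) (at (snd c q)) \<and>
      ((\<lambda>x. g (chart_inv c x)) has_derivative D) (at (snd c q))"
  shows "f p - g p = f q - g q"
proof (rule connected_local_const[OF assms(1), where f = "\<lambda>p. f p - g p"], simp, simp, rule ballI)
  fix p
  obtain W k where W: "open W" "p \<in> W" "\<And>q. q \<in> W \<Longrightarrow> f q = g q + k"
    using equal_derivatives_imp_locally_constant_difference[of UNIV p f g] D by auto
  show "eventually (\<lambda>q. f p - g p = f q - g q) (at p)"
    unfolding eventually_at_topological using W by (intro exI[of _ W]) auto
qed

lemma chart_derivative_imp_continuous: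
  assumes "\<And>p c. c \<in> charts_at A p \<Longrightarrow> \<exists>D. ((\<lambda>x. f (chart_inv c x)) has_derivative D) (at (snd c p))"
  shows "continuous_on UNIV f"
proof (rule continuous_at_imp_continuous_on, rule ballI)
  fix p
  obtain c where c: "c \<in> charts_at A p" using ex_chart_at by blast
  note cA = charts_atD(1)[OF c] and cp = charts_atD(2)[OF c]
  have "isCont (snd c) p"
    using chart_homeomorphism[OF cA] open_domain[OF cA] cp
    by (auto simp: homeomorphism_def continuous_on_eq_continuous_at)
  moreover have "isCont (\<lambda>x. f (chart_inv c x)) (snd c p)"
    using assms[OF c] has_derivative_continuous by blast
  ultimately have "isCont (\<lambda>q. f (chart_inv c (snd c q))) p"
    by (rule isCont_o2)
  moreover have "eventually (\<lambda>q. f (chart_inv c (snd c q)) = f q) (nhds p)"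
    unfolding eventually_nhds using open_domain[OF cA] cp cA by (intro exI[of _ "fst c"]) (auto simp: chart_inv_left)
  ultimately show "isCont f p"
    using isCont_cong by fastforce
qed

end

text \<open>
  If \<open>V' \<circ> F = DF \<cdot> V\<close>, then differentiating in direction \<open>W\<close> gives \<open>DV'(DF W) = D\<^sup>2F(W, V) + DF(DV W)\<close>.
  In the bracket the terms with \<open>D\<^sup>2F\<close> cancel by symmetry.
\<close>
lemma bracket_pushforward:
  fixes F :: "'a::fin_dim_normed_vector \<Rightarrow> 'b::fin_dim_normed_vector"
  assumes N: "open N" "x \<in> N" and F: "smooth_on N F"
    and V: "(V has_derivative DV) (at x)" and W: "(W has_derivative DW) (at x)"
    and V': "(V' has_derivative DV') (at (F x))" and W': "(W' has_derivative DW') (at (F x))"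
    and FV: "\<And>y. y \<in> N \<Longrightarrow> V' (F y) = frechet_derivative F (at y) (V y)"
    and FW: "\<And>y. y \<in> N \<Longrightarrow> W' (F y) = frechet_derivative F (at y) (W y)"
  shows "DW' (V' (F x)) - DV' (W' (F x)) = frechet_derivative F (at x) (DW (V x) - DV (W x))"
proof -
  obtain F' where F': "\<And>y. y \<in> N \<Longrightarrow> (F has_derivative blinfun_apply (F' y)) (at y)" "smooth_on N F'"
    using smooth_on_blinfun_derivative[OF N(1) F] by blast
  obtain F'' where F'': "(F' has_derivative F'') (at x)"
    using smooth_on_has_derivative[OF F'(2) N(2)] by blast
  have fF: "frechet_derivative F (at y) = blinfun_apply (F' y)" if "y \<in> N" for y
    using frechet_derivative_at[OF F'(1)[OF that]] by simp
  have push: "DU' (F' x w) = F'' w (U x) + F' x (DU w)"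
    if U: "(U has_derivative DU) (at x)" and U': "(U' has_derivative DU') (at (F x))"
      and FU: "\<And>y. y \<in> N \<Longrightarrow> U' (F y) = frechet_derivative F (at y) (U y)" for U DU U' DU' w
  proof -
    have "((\<lambda>y. U' (F y)) has_derivative (\<lambda>w. DU' (F' x w))) (at x)"
      by (rule has_derivative_compose[OF F'(1)[OF N(2)] U'])
    moreover have "((\<lambda>y. U' (F y)) has_derivative (\<lambda>w. F' x (DU w) + F'' w (U x))) (at x)"
      by (rule has_derivative_transform_within_open[OF blinfun.FDERIV[OF F'' U] N]) (simp add: FU fF)
    ultimately have "(\<lambda>w. DU' (F' x w)) = (\<lambda>w. F' x (DU w) + F'' w (U x))"
      by (rule has_derivative_unique)
    then show ?thesis by (metis add.commute)
  qed
  have sym: "F'' (V x) (W x) = F'' (W x) (V x)"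
    by (rule symmetric_second_derivative[OF N F'(1) F''])
  show ?thesis
    using push[OF V V' FV, of "W x"] push[OF W W' FW, of "V x"] sym
    by (simp add: FV[OF N(2)] FW[OF N(2)] fF[OF N(2)] blinfun.diff_right)
qed

text \<open>
  Naturality of the exterior derivative, for a pullback that is known up to a fixed linear map \<open>T\<close> of
  the values. Differentiating \<open>\<beta>(F y)(DF(y) b)\<close> in direction \<open>a\<close> gives \<open>\<beta>'(DF a)(DF b) + \<beta>(D\<^sup>2F(a, b))\<close>, and
  the last term is symmetric. Surjectivity of \<open>DF\<close> reaches all pairs of vectors.
\<close>
lemma closed_pushforward:
  fixes F :: "'a::fin_dim_normed_vector \<Rightarrow> 'b::fin_dim_normed_vector"
  assumes N: "open N" "x \<in> N" and F: "smooth_on N F"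
    and surj: "surj (frechet_derivative F (at x))"
    and \<alpha>: "(\<alpha> has_derivative blinfun_apply \<alpha>') (at x)"
    and \<beta>: "(\<beta> has_derivative blinfun_apply \<beta>') (at (F x))"
    and pullback: "\<And>y v. y \<in> N \<Longrightarrow>
      blinfun_apply (\<beta> (F y)) (frechet_derivative F (at y) v) = blinfun_apply T (blinfun_apply (\<alpha> y) v)"
    and closed: "\<And>v w. blinfun_apply (blinfun_apply \<alpha>' v) w = blinfun_apply (blinfun_apply \<alpha>' w) v"
  shows "blinfun_apply (blinfun_apply \<beta>' v) w = blinfun_apply (blinfun_apply \<beta>' w) v"
proof -
  obtain F' where F': "\<And>y. y \<in> N \<Longrightarrow> (F has_derivative blinfun_apply (F' y)) (at y)" "smooth_on N F'"
    using smooth_on_blinfun_derivative[OF N(1) F] by blast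
  obtain F'' where F'': "(F' has_derivative F'') (at x)"
    using smooth_on_has_derivative[OF F'(2) N(2)] by blast
  have fF: "frechet_derivative F (at y) = blinfun_apply (F' y)" if "y \<in> N" for y
    using frechet_derivative_at[OF F'(1)[OF that]] by simp
  have d: "\<beta>' (F' x a) (F' x b) + \<beta> (F x) (F'' a b) = T (\<alpha>' a b)" for a b
  proof -
    have "((\<lambda>y. F' y b) has_derivative (\<lambda>a. F'' a b)) (at x)"
      by (rule bounded_linear.has_derivative[OF blinfun.bounded_linear_left F''])
    from blinfun.FDERIV[OF has_derivative_compose[OF F'(1)[OF N(2)] \<beta>] this]
    have "((\<lambda>y. \<beta> (F y) (F' y b)) has_derivative (\<lambda>a. \<beta> (F x) (F'' a b) + \<beta>' (F' x a) (F' x b))) (at x)" .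
    moreover have "((\<lambda>y. T (\<alpha> y b)) has_derivative (\<lambda>a. T (\<alpha>' a b))) (at x)"
      by (intro bounded_linear.has_derivative[OF blinfun.bounded_linear_right]
        bounded_linear.has_derivative[OF blinfun.bounded_linear_left] \<alpha>)
    then have "((\<lambda>y. \<beta> (F y) (F' y b)) has_derivative (\<lambda>a. T (\<alpha>' a b))) (at x)"
      by (rule has_derivative_transform_within_open[OF _ N]) (simp flip: pullback add: fF)
    ultimately have "(\<lambda>a. \<beta> (F x) (F'' a b) + \<beta>' (F' x a) (F' x b)) = (\<lambda>a. T (\<alpha>' a b))"
      by (rule has_derivative_unique)
    then show ?thesis by (metis add.commute)
  qed
  obtain a b where ab: "v = F' x a" "w = F' x b"
    using surj fF[OF N(2)] by (metis surjD)
  have "F'' a b = F'' b a" by (rule symmetric_second_derivative[OF N F'(1) F''])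
  then show ?thesis using d[of a b] d[of b a] closed[of a b] ab by (metis add_right_cancel)
qed

section \<open>Left translations and the Maurer-Cartan form\<close>

context lie_group
begin

lemma in_carrier [simp]: "g \<in> carrier G"
  by (simp add: carrier_UNIV)

definition mult_domain :: "('g, 'v) chart \<Rightarrow> ('g, 'v) chart \<Rightarrow> ('g, 'v) chart \<Rightarrow> ('v \<times> 'v) set" where
  "mult_domain a b d = {z. fst z \<in> snd a ` fst a \<and> snd z \<in> snd b ` fst b \<and>
    chart_inv a (fst z) \<otimes> chart_inv b (snd z) \<in> fst d}"

definition mult_coord :: "('g, 'v) chart \<Rightarrow> ('g, 'v) chart \<Rightarrow> ('g, 'v) chart \<Rightarrow> 'v \<times> 'v \<Rightarrow> 'v" where
  "mult_coord a b d z = snd d (chart_inv a (fst z) \<otimes> chart_inv b (snd z))"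

lemma continuous_mult: "continuous_on UNIV (\<lambda>z. fst z \<otimes> snd z)"
  using smooth_mult unfolding smooth_map_def by (simp add: split_beta)

lemma
  assumes abd: "a \<in> A" "b \<in> A" "d \<in> A"
  shows open_mult_domain: "open (mult_domain a b d)"
    and smooth_mult_coord: "smooth_on (mult_domain a b d) (mult_coord a b d)"
proof -
  let ?c = "(fst a \<times> fst b, map_prod (snd a) (snd b))"
  have inv: "chart_inv ?c (map_prod (snd a) (snd b) z) = z" if "z \<in> fst a \<times> fst b" for z
  proof -
    have "inj_on (snd c) (fst c)" if "c \<in> A" for c
      by (rule inj_on_inverseI[where g = "chart_inv c"]) (simp add: chart_inv_left that)
    from this[OF abd(1)] this[OF abd(2)] have "inj_on (map_prod (snd a) (snd b)) (fst a \<times> fst b)" by (rule map_prod_inj_on)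
    then show ?thesis using that by (simp add: chart_inv_def)
  qed
  have dom: "map_prod (snd a) (snd b) ` ((fst a \<times> fst b) \<inter> (\<lambda>(g, h). g \<otimes> h) -` fst d) = mult_domain a b d"
  proof (intro equalityI subsetI)
    fix z assume "z \<in> mult_domain a b d"
    then obtain g h where "g \<in> fst a" "h \<in> fst b" "z = (snd a g, snd b h)" "g \<otimes> h \<in> fst d"
      using abd by (cases z) (auto simp: mult_domain_def chart_inv_left)
    then show "z \<in> map_prod (snd a) (snd b) ` ((fst a \<times> fst b) \<inter> (\<lambda>(g, h). g \<otimes> h) -` fst d)"
      by (intro image_eqI[of _ _ "(g, h)"]) simp_all
  qed (use abd in \<open>auto simp: mult_domain_def chart_inv_left\<close>)
  have inv': "chart_inv ?c z = (chart_inv a (fst z), chart_inv b (snd z))" if z: "z \<in> mult_domain a b d" for z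
  proof -
    obtain g h where "g \<in> fst a" "h \<in> fst b" "z = (snd a g, snd b h)"
      using z by (cases z) (auto simp: mult_domain_def)
    then show ?thesis using inv[of "(g, h)"] abd by (simp add: chart_inv_left)
  qed
  have ci: "continuous_on (snd c ` fst c) (chart_inv c)" if "c \<in> A" for c
    using chart_homeomorphism[OF that] by (simp add: homeomorphism_def)
  have "continuous_on (snd a ` fst a \<times> snd b ` fst b) (\<lambda>z. chart_inv a (fst z))"
    by (rule continuous_on_compose2[OF ci[OF abd(1)] continuous_on_fst[OF continuous_on_id]]) auto
  moreover have "continuous_on (snd a ` fst a \<times> snd b ` fst b) (\<lambda>z. chart_inv b (snd z))"
    by (rule continuous_on_compose2[OF ci[OF abd(2)] continuous_on_snd[OF continuous_on_id]]) auto
  ultimately have "continuous_on (snd a ` fst a \<times> snd b ` fst b) (\<lambda>z. chart_inv a (fst z) \<otimes> chart_inv b (snd z))"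
    using continuous_on_compose2[OF continuous_mult, of _ "\<lambda>z. (chart_inv a (fst z), chart_inv b (snd z))"]
    by (simp add: continuous_on_Pair)
  then have "open ((snd a ` fst a \<times> snd b ` fst b) \<inter> (\<lambda>z. chart_inv a (fst z) \<otimes> chart_inv b (snd z)) -` fst d)"
    using abd by (intro continuous_open_preimage open_Times open_image open_domain)
  moreover have "mult_domain a b d =
      (snd a ` fst a \<times> snd b ` fst b) \<inter> (\<lambda>z. chart_inv a (fst z) \<otimes> chart_inv b (snd z)) -` fst d"
    by (auto simp: mult_domain_def mem_Times_iff)
  ultimately show op: "open (mult_domain a b d)" by simp
  have "?c \<in> prod_atlas A A" using abd unfolding prod_atlas_def by blast
  then have "smooth_on (mult_domain a b d) (snd d \<circ> (\<lambda>(g, h). g \<otimes> h) \<circ> chart_inv ?c)"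
    using smooth_mult abd(3) unfolding smooth_map_def dom[symmetric] by fastforce
  then show "smooth_on (mult_domain a b d) (mult_coord a b d)"
    by (rule smooth_on_cong[OF op, rotated]) (simp add: inv' mult_coord_def)
qed

lemma mult_coord_slice_derivative:
  assumes abd: "a \<in> A" "b \<in> A" "d \<in> A" and z: "(y, x) \<in> mult_domain a b d"
  shows "((\<lambda>x. snd d (chart_inv a y \<otimes> chart_inv b x)) has_derivative
    (\<lambda>v. frechet_derivative (mult_coord a b d) (at (y, x)) (0, v))) (at x)"
proof -
  have "((\<lambda>x. (y, x)) has_derivative (\<lambda>v. (0, v))) (at x)"
    by (intro has_derivative_Pair has_derivative_const has_derivative_ident)
  from has_derivative_compose[OF this smooth_on_has_derivative[OF smooth_mult_coord[OF abd] z]]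
  show ?thesis by (simp add: mult_coord_def)
qed

text \<open>
  A left translation is the multiplication with its first argument fixed, so in charts it is the smooth map
  \<open>mult_coord\<close> composed with the affine map \<open>x \<mapsto> (snd a g, x)\<close>.
\<close>
lemma smooth_left_mult: "smooth_map A A (\<lambda>h. g \<otimes> h)"
proof -
  have cont: "continuous_on UNIV (\<lambda>h. g \<otimes> h)"
    using continuous_on_compose2[OF continuous_mult, of UNIV "\<lambda>h. (g, h)"] by (simp add: continuous_on_Pair)
  obtain a where a: "a \<in> charts_at A g" using ex_chart_at by blast
  have "smooth_on (snd c ` (fst c \<inter> (\<lambda>h. g \<otimes> h) -` fst d)) (\<lambda>x. snd d (g \<otimes> chart_inv c x))"
    if cd: "c \<in> A" "d \<in> A" for c d
  proof -
    let ?N = "snd c ` (fst c \<inter> (\<lambda>h. g \<otimes> h) -` fst d)"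
    have N: "open ?N" using cont open_domain[OF cd(2)] cd(1)
      by (intro open_chart_image) (simp_all add: continuous_on_open_vimage)
    have ga: "chart_inv a (snd a g) = g" "g \<in> fst a" "a \<in> A"
      using a by (simp_all add: charts_atD chart_inv_left)
    have "smooth_on ?N (\<lambda>x. mult_coord a c d (snd a g, x))"
    proof (rule smooth_on_compose[OF N, where f = "Pair (snd a g)" and T = "mult_domain a c d"])
      show "smooth_on (mult_domain a c d) (mult_coord a c d)" by (rule smooth_mult_coord[OF ga(3) cd])
      show "smooth_on ?N (Pair (snd a g))"
        by (intro smooth_on_Pair smooth_on_const smooth_on_ident N)
      show "Pair (snd a g) ` ?N \<subseteq> mult_domain a c d"
        using ga cd by (auto simp: mult_domain_def chart_inv_left)
    qed
    then show ?thesis by (simp add: mult_coord_def ga)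
  qed
  then show ?thesis using cont unfolding smooth_map_def comp_def by blast
qed

lemma continuous_left_mult: "continuous_on UNIV (\<lambda>h. g \<otimes> h)"
  using smooth_left_mult unfolding smooth_map_def by blast

text \<open>
  The chart around \<open>e\<close> that \<^const>\<open>tangent_map\<close> selects. With this choice a tangent map at \<open>e\<close> is literally the
  derivative in this chart (\<open>vs_tangent_map_eq\<close>).
\<close>
definition base :: "('g, 'v) chart" where
  "base = (SOME c. c \<in> charts_at A \<one>)"

lemma base_chart: "base \<in> charts_at A \<one>"
  unfolding base_def using ex_chart_at by (rule someI_ex)

lemmas base_in_atlas = charts_atD(1)[OF base_chart]

lemma base_inv: "chart_inv base (snd base \<one>) = \<one>"
  using base_chart by (simp add: charts_atD chart_inv_left)

text \<open>
  The differential at \<open>h\<close> of the left translation by \<open>g\<close>, from the chart \<open>c\<close> to the chart \<open>d\<close>. Changes of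
  charts are the case \<open>g = e\<close>, so that the one functoriality law \<open>left_diff_compose\<close> covers both.
\<close>
definition left_diff :: "'g \<Rightarrow> ('g, 'v) chart \<Rightarrow> ('g, 'v) chart \<Rightarrow> 'g \<Rightarrow> 'v \<Rightarrow> 'v" where
  "left_diff g c d h = frechet_derivative (\<lambda>x. snd d (g \<otimes> chart_inv c x)) (at (snd c h))"

lemma left_diff:
  assumes "c \<in> charts_at A h" "d \<in> charts_at A (g \<otimes> h)"
  shows "((\<lambda>x. snd d (g \<otimes> chart_inv c x)) has_derivative left_diff g c d h) (at (snd c h))"
  unfolding left_diff_def using smooth_left_mult assms by (rule smooth_map_chart_derivative)

lemma left_translate_has_derivative:
  assumes "c \<in> charts_at A h" "d \<in> charts_at A (g \<otimes> h)"
    and "((\<lambda>y. f (chart_inv d y)) has_derivative Q) (at (snd d (g \<otimes> h)))"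
  shows "((\<lambda>x. f (g \<otimes> chart_inv c x)) has_derivative (\<lambda>v. Q (left_diff g c d h v))) (at (snd c h))"
  by (rule chart_chain_rule[OF assms(1,2) continuous_left_mult left_diff[OF assms(1,2)] assms(3)])

lemma left_diff_compose:
  assumes "c \<in> charts_at A h" "d \<in> charts_at A (g \<otimes> h)" "b \<in> charts_at A (k \<otimes> (g \<otimes> h))"
  shows "left_diff k d b (g \<otimes> h) (left_diff g c d h v) = left_diff (k \<otimes> g) c b h v"
proof -
  have "((\<lambda>x. snd b (k \<otimes> (g \<otimes> chart_inv c x))) has_derivative
      (\<lambda>v. left_diff k d b (g \<otimes> h) (left_diff g c d h v))) (at (snd c h))"
    using left_translate_has_derivative[OF assms(1,2) left_diff[OF assms(2,3)]] .
  moreover have "((\<lambda>x. snd b (k \<otimes> (g \<otimes> chart_inv c x))) has_derivative left_diff (k \<otimes> g) c b h) (at (snd c h))"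
    using left_diff[of c h b "k \<otimes> g"] assms by (simp add: m_assoc)
  ultimately show ?thesis by (metis has_derivative_unique)
qed

lemma left_diff_ident:
  assumes "c \<in> charts_at A h"
  shows "left_diff \<one> c c h v = v"
proof -
  have "((\<lambda>x. snd c (chart_inv c x)) has_derivative left_diff \<one> c c h) (at (snd c h))"
    using left_diff[of c h c \<one>] assms by simp
  moreover have "((\<lambda>x. snd c (chart_inv c x)) has_derivative (\<lambda>v. v)) (at (snd c h))"
    by (rule has_derivative_transform_within_open[OF has_derivative_ident open_image[OF charts_atD(1)[OF assms]]])
      (use assms in \<open>simp_all add: charts_atD chart_inv_right\<close>)
  ultimately show ?thesis by (metis has_derivative_unique)
qed

lemma left_diff_linear: "c \<in> charts_at A h \<Longrightarrow> d \<in> charts_at A (g \<otimes> h) \<Longrightarrow> bounded_linear (left_diff g c d h)"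
  using left_diff has_derivative_bounded_linear by blast

text \<open>
  The tangent vector at \<open>e\<close> with coordinate vector \<open>u\<close>. It identifies the model space with the Lie
  algebra.
\<close>
definition tangent_of :: "'v \<Rightarrow> ('g, 'v) tangent" where
  "tangent_of u = (\<lambda>d. if d \<in> charts_at A \<one> then left_diff \<one> base d \<one> u else 0)"

lemma tangent_of_base [simp]: "tangent_of u base = u"
  by (simp add: tangent_of_def base_chart left_diff_ident)

lemma transition_diff:
  "frechet_derivative (snd d \<circ> chart_inv c) (at (snd c h)) = left_diff \<one> c d h"
  by (simp add: left_diff_def comp_def)

lemma tangent_of_in: "tangent_of u \<in> lie_algebra G A"
  unfolding lie_algebra_def tangent_space_def mem_Collect_eq
proof (intro conjI allI ballI impI)
  fix c d assume "c \<in> charts_at A \<one>" "d \<in> charts_at A \<one>"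
  then show "tangent_of u d = frechet_derivative (snd d \<circ> chart_inv c) (at (snd c \<one>)) (tangent_of u c)"
    using left_diff_compose[of base \<one> c \<one> d \<one> u] base_chart by (simp add: tangent_of_def transition_diff)
qed (simp add: tangent_of_def)

lemma tangent_of_eqI:
  assumes "\<And>d. d \<notin> charts_at A \<one> \<Longrightarrow> X d = 0"
    and "\<And>d. d \<in> charts_at A \<one> \<Longrightarrow> X d = left_diff \<one> base d \<one> (X base)"
  shows "tangent_of (X base) = X"
  using assms by (auto simp: tangent_of_def)

lemma lie_algebra_eq_tangent_of:
  assumes "X \<in> lie_algebra G A"
  shows "tangent_of (X base) = X"
proof (rule tangent_of_eqI)
  show "X d = 0" if "d \<notin> charts_at A \<one>" for d
    using assms that unfolding lie_algebra_def tangent_space_def by blast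
  show "X d = left_diff \<one> base d \<one> (X base)" if "d \<in> charts_at A \<one>" for d
    using assms that base_chart unfolding lie_algebra_def tangent_space_def transition_diff by blast
qed

lemma vs_tangent_map_eq:
  "vs_tangent_map A f \<one> X = frechet_derivative (\<lambda>x. f (chart_inv base x)) (at (snd base \<one>)) (X base)"
  by (simp add: vs_tangent_map_def tangent_map_def vs_atlas_def charts_at_def comp_def Let_def
    base_def[unfolded charts_at_def])

lemma tangent_of_linear:
  "tangent_of (u + w) = (\<lambda>c. tangent_of u c + tangent_of w c)"
  "tangent_of (a *\<^sub>R u) = (\<lambda>c. a *\<^sub>R tangent_of u c)"
proof -
  have lin: "bounded_linear (left_diff \<one> base d \<one>)" if "d \<in> charts_at A \<one>" for d
    using left_diff_linear[OF base_chart, of d \<one>] that by simp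
  show "tangent_of (u + w) = (\<lambda>c. tangent_of u c + tangent_of w c)"
    "tangent_of (a *\<^sub>R u) = (\<lambda>c. a *\<^sub>R tangent_of u c)"
    using lin by (auto simp: tangent_of_def fun_eq_iff bounded_linear.linear linear_add linear_scale)
qed

text \<open>
  The left-invariant vector field with value \<open>u\<close> at \<open>e\<close>, in the chart \<open>d\<close>.
\<close>
definition left_field :: "'v \<Rightarrow> ('g, 'v) chart \<Rightarrow> 'v \<Rightarrow> 'v" where
  "left_field u d x = left_diff (chart_inv d x) base d \<one> u"

lemma vf_coord_left_invariant:
  assumes "d \<in> A" "x \<in> snd d ` fst d"
  shows "vf_coord (left_invariant_vf G A (tangent_of u)) d x = left_field u d x"
  using charts_at_chart_inv[OF assms] tangent_of_base[of u]
  by (simp add: vf_coord_def left_invariant_vf_def tangent_map_def left_field_def left_diff_def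
    comp_def Let_def flip: base_def)

text \<open>
  At \<open>(g, e)\<close> the partial derivative of the multiplication in its second argument is the differential of the
  left translation by \<open>g\<close>, and it depends smoothly on \<open>g\<close>.
\<close>
lemma smooth_left_field:
  assumes d: "d \<in> A"
  shows "smooth_on (snd d ` fst d) (left_field u d)"
proof -
  let ?S = "snd d ` fst d" and ?o = "snd base \<one>"
  have S: "open ?S" by (rule open_image[OF d])
  have z: "(x, ?o) \<in> mult_domain d base d" if "x \<in> ?S" for x
    using that d base_chart by (auto simp: mult_domain_def chart_inv_left base_inv charts_atD)
  have sm: "smooth_on ?S (\<lambda>x. frechet_derivative (mult_coord d base d) (at (x, ?o)) (0, u))"
    by (rule smooth_on_compose[OF S _ _ smooth_on_derivative[OF smooth_mult_coord[OF d base_in_atlas d]]])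
      (use z S in \<open>auto intro!: smooth_on_Pair smooth_on_const smooth_on_ident\<close>)
  have eq: "frechet_derivative (mult_coord d base d) (at (x, ?o)) (0, u) = left_field u d x" if "x \<in> ?S" for x
    unfolding left_field_def left_diff_def
    using frechet_derivative_at[OF mult_coord_slice_derivative[OF d base_in_atlas d z[OF that]]] by metis
  show ?thesis by (rule smooth_on_cong[OF S eq sm])
qed

lemma left_field_transition:
  assumes d: "d \<in> charts_at A \<one>" and x: "x \<in> snd base ` (fst base \<inter> fst d)"
  shows "left_field u d (snd d (chart_inv base x)) =
    frechet_derivative (\<lambda>x. snd d (chart_inv base x)) (at x) (left_field u base x)"
proof -
  obtain g where g: "g \<in> fst base" "g \<in> fst d" "x = snd base g" using x by blast
  then have ch: "base \<in> charts_at A g" "d \<in> charts_at A g"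
    using base_in_atlas charts_atD(1)[OF d] by (simp_all add: charts_at_def)
  have "left_diff \<one> base d g (left_diff g base base \<one> u) = left_diff g base d \<one> u"
    using left_diff_compose[of base \<one> base g d \<one> u] base_chart ch by simp
  moreover have "left_diff \<one> base d g = frechet_derivative (\<lambda>x. snd d (chart_inv base x)) (at x)"
    using transition_diff[of d base g] g by (simp add: comp_def)
  ultimately show ?thesis
    using g base_in_atlas charts_atD(1)[OF d] by (simp add: left_field_def chart_inv_left)
qed

lemma left_field_at_base: "left_field u d (snd d \<one>) = left_diff \<one> base d \<one> u" if "d \<in> charts_at A \<one>"
  using that by (simp add: left_field_def charts_atD chart_inv_left)

lemma lie_bracket_coord:
  assumes d: "d \<in> charts_at A \<one>"
  shows "lie_bracket G A (tangent_of u) (tangent_of w) d =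
    frechet_derivative (left_field w d) (at (snd d \<one>)) (left_field u d (snd d \<one>)) -
    frechet_derivative (left_field u d) (at (snd d \<one>)) (left_field w d (snd d \<one>))"
proof -
  note dA = charts_atD(1)[OF d] and d1 = charts_atD(2)[OF d]
  have D: "frechet_derivative (vf_coord (left_invariant_vf G A (tangent_of u)) d) (at (snd d \<one>)) =
      frechet_derivative (left_field u d) (at (snd d \<one>))" for u
  proof (rule frechet_derivative_transform_within_open[symmetric])
    show "left_field u d differentiable at (snd d \<one>)"
      using smooth_on_has_derivative[OF smooth_left_field[OF dA]] d1 by (auto simp: differentiable_def)
    show "open (snd d ` fst d)" by (rule open_image[OF dA])
  qed (use d1 dA in \<open>simp_all add: vf_coord_left_invariant\<close>)
  have val: "left_invariant_vf G A (tangent_of u) \<one> d = left_field u d (snd d \<one>)" for u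
    using vf_coord_left_invariant[OF dA, of "snd d \<one>" u] d1 dA by (simp add: vf_coord_def chart_inv_left)
  show ?thesis
    using d by (simp add: lie_bracket_def vf_bracket_def D val)
qed

text \<open>
  The bracket is again a tangent vector at \<open>e\<close>: its coordinates in different charts are related by the
  differential of the transition map, because those of left-invariant fields are.
\<close>
lemma lie_bracket_tangent_of:
  "lie_bracket G A (tangent_of u) (tangent_of w) =
    tangent_of (lie_bracket G A (tangent_of u) (tangent_of w) base)"
proof (rule tangent_of_eqI[symmetric])
  fix d assume d: "d \<in> charts_at A \<one>"
  note dA = charts_atD(1)[OF d] and d1 = charts_atD(2)[OF d]
  let ?F = "\<lambda>x. snd d (chart_inv base x)" and ?N = "snd base ` (fst base \<inter> fst d)" and ?o = "snd base \<one>"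
  have o: "?o \<in> ?N" using base_chart d1 by (auto dest: charts_atD)
  have N: "open ?N" using open_chart_image[OF base_in_atlas open_domain[OF dA]] .
  have F: "smooth_on ?N ?F"
    using smooth_transition[OF base_in_atlas dA] by (simp add: comp_def)
  have der: "(left_field u b has_derivative frechet_derivative (left_field u b) (at (snd b \<one>))) (at (snd b \<one>))"
    if "b \<in> charts_at A \<one>" for u b
    by (rule smooth_on_has_derivative[OF smooth_left_field]) (use that charts_atD in auto)
  have Fo: "?F ?o = snd d \<one>" by (simp add: base_inv)
  have "frechet_derivative ?F (at ?o) = left_diff \<one> base d \<one>"
    using transition_diff[of d base \<one>] by (simp add: comp_def)
  then show "lie_bracket G A (tangent_of u) (tangent_of w) d =
      left_diff \<one> base d \<one> (lie_bracket G A (tangent_of u) (tangent_of w) base)"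
    using bracket_pushforward[OF N o F der[OF base_chart] der[OF base_chart]
      der[OF d, folded Fo] der[OF d, folded Fo] left_field_transition[OF d] left_field_transition[OF d], of w u]
    by (simp add: lie_bracket_coord d base_chart Fo)
qed (simp add: lie_bracket_def vf_bracket_def)

text \<open>
  The left-invariant form with values in the Lie algebra that is the identity at \<open>e\<close>.
\<close>
definition maurer_cartan :: "('g, 'v) chart \<Rightarrow> 'g \<Rightarrow> 'v \<Rightarrow> 'v" where
  "maurer_cartan c g = left_diff (inv g) c base g"

text \<open>
  Left invariance: translating by \<open>g\<close> and then by \<open>(gh)\<^sup>-\<^sup>1\<close> is translating by \<open>h\<^sup>-\<^sup>1\<close>.
\<close>
lemma maurer_cartan_left_diff:
  assumes "c \<in> charts_at A h" "d \<in> charts_at A (g \<otimes> h)"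
  shows "maurer_cartan d (g \<otimes> h) (left_diff g c d h v) = maurer_cartan c h v"
proof -
  have "inv (g \<otimes> h) \<otimes> (g \<otimes> h) = \<one>" by simp
  moreover have "inv (g \<otimes> h) \<otimes> g = inv h" by (simp add: inv_mult_group m_assoc)
  ultimately show ?thesis
    unfolding maurer_cartan_def using left_diff_compose[OF assms, of base "inv (g \<otimes> h)" v] base_chart by simp
qed

lemma maurer_cartan_linear: "c \<in> charts_at A g \<Longrightarrow> bounded_linear (maurer_cartan c g)"
  unfolding maurer_cartan_def using left_diff_linear[of c g base "inv g"] base_chart by simp

lemma maurer_cartan_base: "maurer_cartan base \<one> v = v"
  unfolding maurer_cartan_def using left_diff_ident[OF base_chart] by simp

lemma maurer_cartan_left_field:
  assumes "d \<in> A" "x \<in> snd d ` fst d"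
  shows "maurer_cartan d (chart_inv d x) (left_field u d x) = u"
  unfolding left_field_def
  using maurer_cartan_left_diff[of base \<one> d "chart_inv d x" u] base_chart charts_at_chart_inv[OF assms]
  by (simp add: maurer_cartan_base)

text \<open>
  In coordinates, left translation by \<open>g\<^sup>-\<^sup>1\<close> is the multiplication with its first argument fixed at the
  coordinate \<open>?i x\<close> of \<open>g\<^sup>-\<^sup>1\<close>, where \<open>x\<close> is that of \<open>g\<close>. So the form is a partial derivative of the
  multiplication, composed with the smooth map \<open>x \<mapsto> (?i x, x)\<close>.
\<close>
lemma smooth_maurer_cartan:
  assumes c: "c \<in> A"
  shows "smooth_on (snd c ` fst c) (\<lambda>x. maurer_cartan c (chart_inv c x) v)"
proof (rule smooth_on_local)
  fix x0 assume "x0 \<in> snd c ` fst c"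
  then obtain g0 where g0: "g0 \<in> fst c" "x0 = snd c g0" by blast
  obtain a where a: "a \<in> charts_at A (inv g0)" using ex_chart_at by blast
  note aA = charts_atD(1)[OF a]
  let ?N = "snd c ` (fst c \<inter> (\<lambda>g. inv g) -` fst a)"
  let ?i = "\<lambda>x. snd a (inv (chart_inv c x))"
  have N: "open ?N" and i: "smooth_on ?N ?i"
    using smooth_map_chart[OF smooth_inv c aA] by blast+
  have z: "(?i x, x) \<in> mult_domain a c base" if "x \<in> ?N" for x
    using that c aA base_chart by (auto simp: mult_domain_def chart_inv_left charts_atD)
  have sm: "smooth_on ?N (\<lambda>x. frechet_derivative (mult_coord a c base) (at (?i x, x)) (0, v))"
    by (rule smooth_on_compose[OF N _ _ smooth_on_derivative[OF smooth_mult_coord[OF aA c base_in_atlas]]])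
      (use z N i in \<open>auto intro!: smooth_on_Pair smooth_on_ident\<close>)
  have eq: "frechet_derivative (mult_coord a c base) (at (?i x, x)) (0, v) = maurer_cartan c (chart_inv c x) v"
    if x: "x \<in> ?N" for x
  proof -
    have "chart_inv a (?i x) = inv (chart_inv c x)" "snd c (chart_inv c x) = x"
      using x c aA by (auto simp: chart_inv_left)
    then show ?thesis
      unfolding maurer_cartan_def left_diff_def
      using frechet_derivative_at[OF mult_coord_slice_derivative[OF aA c base_in_atlas z[OF x]]] by metis
  qed
  have "smooth_on ?N (\<lambda>x. maurer_cartan c (chart_inv c x) v)"
    by (rule smooth_on_cong[OF N eq sm])
  moreover have "x0 \<in> ?N" using g0 charts_atD(2)[OF a] by auto
  ultimately show "\<exists>T. open T \<and> x0 \<in> T \<and> smooth_on T (\<lambda>x. maurer_cartan c (chart_inv c x) v)"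
    using N by blast
qed

end

section \<open>Integration of Lie algebra cocycles\<close>

locale lie_algebra_one_cocycle = lie_group G A
  for G :: "('g::{t2_space, second_countable_topology}, 'm) monoid_scheme" (structure)
    and A :: "('g, 'v::fin_dim_normed_vector) chart set" +
  fixes R :: "'g \<Rightarrow> 'e::fin_dim_normed_vector \<Rightarrow>\<^sub>L 'e"
    and \<Theta> :: "('g, 'v) tangent \<Rightarrow> 'e"
  assumes rep: "lie_group_rep G A R"
    and cocycle: "lie_algebra_cocycle G A (lie_algebra_rep G A R) \<Theta>"
begin

lemma smooth_rep: "smooth_map A vs_atlas R"
  using rep by (simp add: lie_group_rep_def)

lemma rep_mult: "R (g \<otimes> h) = R g o\<^sub>L R h"
  using rep hom_mult[of R G GL g h] by (simp add: lie_group_rep_def GL_def)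

lemma rep_one: "R \<one> = id_blinfun"
proof -
  have "R \<one> \<in> carrier GL" using rep hom_in_carrier[of R G GL \<one>] by (simp add: lie_group_rep_def)
  then obtain T where T: "T o\<^sub>L R \<one> = id_blinfun" unfolding GL_def by auto
  have "R \<one> v = v" for v
  proof -
    have "T (R \<one> w) = w" for w by (metis T blinfun_apply_blinfun_compose blinfun_apply_id_blinfun)
    moreover have "R \<one> (R \<one> v) = R \<one> v" using rep_mult[of \<one> \<one>] by (metis blinfun_apply_blinfun_compose r_one in_carrier)
    ultimately show ?thesis by metis
  qed
  then show ?thesis by (simp add: blinfun_eqI)
qed

lemma rep_diff:
  "((\<lambda>x. R (chart_inv base x)) has_derivative (\<lambda>u. lie_algebra_rep G A R (tangent_of u))) (at (snd base \<one>))"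
  using smooth_map_vs_has_derivative[OF smooth_rep base_chart]
  by (rule has_derivative_eq_rhs) (simp add: fun_eq_iff lie_algebra_rep_def vs_tangent_map_eq)

text \<open>
  \<open>\<Theta>\<close> in the coordinates of the chart \<open>base\<close>, which is the value at \<open>e\<close> of \<open>\<omega>\<close>.
\<close>
definition value_at_one :: "'v \<Rightarrow> 'e" where
  "value_at_one u = \<Theta> (tangent_of u)"

lemma bounded_linear_value_at_one: "bounded_linear value_at_one"
proof (rule fin_dim_linear_imp_bounded_linear, rule linearI)
  show "value_at_one (u + w) = value_at_one u + value_at_one w"
    "value_at_one (a *\<^sub>R u) = a *\<^sub>R value_at_one u" for u w a
    using cocycle tangent_of_in
    by (simp_all add: value_at_one_def tangent_of_linear lie_algebra_cocycle_def)
qed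

text \<open>
  The form \<open>\<omega>\<close> in the chart \<open>c\<close>: the derivative that a group cocycle integrating \<open>\<Theta>\<close> must have.
\<close>
definition cocycle_form :: "('g, 'v) chart \<Rightarrow> 'g \<Rightarrow> 'v \<Rightarrow>\<^sub>L 'e" where
  "cocycle_form c g = Blinfun (\<lambda>v. R g (value_at_one (maurer_cartan c g v)))"

lemma form_apply: "c \<in> charts_at A g \<Longrightarrow> cocycle_form c g v = R g (value_at_one (maurer_cartan c g v))"
  unfolding cocycle_form_def
  by (subst bounded_linear_Blinfun_apply)
    (intro bounded_linear_compose[OF blinfun.bounded_linear_right]
      bounded_linear_compose[OF bounded_linear_value_at_one] maurer_cartan_linear | simp)+

lemma form_one: "cocycle_form base \<one> v = value_at_one v"
  by (simp add: form_apply base_chart rep_one maurer_cartan_base)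

lemma smooth_form:
  assumes c: "c \<in> A"
  shows "smooth_on (snd c ` fst c) (\<lambda>x. cocycle_form c (chart_inv c x))"
proof (rule smooth_on_blinfun[OF open_image[OF c]])
  fix v
  have eq: "R (chart_inv c x) (value_at_one (maurer_cartan c (chart_inv c x) v)) = cocycle_form c (chart_inv c x) v"
    if "x \<in> snd c ` fst c" for x
    using charts_at_chart_inv[OF c that] by (simp add: form_apply)
  have sm: "smooth_on (snd c ` fst c) (\<lambda>x. R (chart_inv c x) (value_at_one (maurer_cartan c (chart_inv c x) v)))"
    using smooth_rep c
    by (intro smooth_on_bounded_bilinear[OF open_image[OF c] bounded_bilinear_blinfun_apply]
        smooth_on_bounded_linear[OF open_image[OF c] bounded_linear_value_at_one] smooth_maurer_cartan)
      (simp_all add: smooth_map_vs_iff)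
  show "smooth_on (snd c ` fst c) (\<lambda>x. cocycle_form c (chart_inv c x) v)"
    by (rule smooth_on_cong[OF open_image[OF c] eq sm])
qed

text \<open>
  Equivariance \<open>L\<^sub>g\<^sup>*\<omega> = R(g) \<omega>\<close>: the Maurer-Cartan form is invariant, and \<open>R(gh) = R(g) R(h)\<close>.
\<close>
lemma form_left_diff:
  assumes "c \<in> charts_at A h" "d \<in> charts_at A (g \<otimes> h)"
  shows "cocycle_form d (g \<otimes> h) (left_diff g c d h v) = R g (cocycle_form c h v)"
  using assms by (simp add: form_apply maurer_cartan_left_diff rep_mult)

text \<open>
  This is the infinitesimal content of the cocycle identity of \<open>\<Theta>\<close>. On the left-invariant field of \<open>u\<close> the
  form has the value \<open>R(g)(\<Theta>(u))\<close>, whose derivative at \<open>e\<close> in direction \<open>w\<close> is \<open>r(w)(\<Theta>(u))\<close>. The product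
  rule splits this derivative into that of the form and that of the field (\<open>split\<close>); antisymmetrized in
  \<open>u\<close> and \<open>w\<close>, the latter is \<open>\<Theta>\<close> of the bracket.
\<close>
lemma form_closed_at_one:
  assumes \<alpha>: "((\<lambda>x. cocycle_form base (chart_inv base x)) has_derivative blinfun_apply \<alpha>') (at (snd base \<one>))"
  shows "blinfun_apply (blinfun_apply \<alpha>' u) w = blinfun_apply (blinfun_apply \<alpha>' w) u"
proof -
  let ?o = "snd base \<one>" and ?S = "snd base ` fst base"
  let ?r = "lie_algebra_rep G A R"
  define D where "D u = frechet_derivative (left_field u base) (at ?o)" for u
  have S: "open ?S" "?o \<in> ?S" using base_chart open_image[OF base_in_atlas] charts_atD by auto
  have field: "left_field u base ?o = u" for u
    by (simp add: left_field_at_base base_chart left_diff_ident)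
  have split: "value_at_one (D u w) + \<alpha>' w u = ?r (tangent_of w) (value_at_one u)" for u w
  proof -
    have "(left_field u base has_derivative D u) (at ?o)"
      unfolding D_def by (rule smooth_on_has_derivative[OF smooth_left_field[OF base_in_atlas] S(2)])
    from blinfun.FDERIV[OF \<alpha> this]
    have d1: "((\<lambda>x. cocycle_form base (chart_inv base x) (left_field u base x)) has_derivative
        (\<lambda>w. value_at_one (D u w) + \<alpha>' w u)) (at ?o)"
      by (simp add: base_inv form_one field)
    have d2: "((\<lambda>x. cocycle_form base (chart_inv base x) (left_field u base x)) has_derivative
        (\<lambda>w. ?r (tangent_of w) (value_at_one u))) (at ?o)"
    proof (rule has_derivative_transform_within_open[OF _ S])
      show "((\<lambda>x. R (chart_inv base x) (value_at_one u)) has_derivative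
          (\<lambda>w. ?r (tangent_of w) (value_at_one u))) (at ?o)"
        by (rule bounded_linear.has_derivative[OF blinfun.bounded_linear_left rep_diff])
      show "R (chart_inv base x) (value_at_one u) = cocycle_form base (chart_inv base x) (left_field u base x)"
        if "x \<in> ?S" for x
        using charts_at_chart_inv[OF base_in_atlas that] maurer_cartan_left_field[OF base_in_atlas that]
        by (simp add: form_apply)
    qed
    show ?thesis using fun_cong[OF has_derivative_unique[OF d1 d2], of w] by simp
  qed
  have br: "lie_bracket G A (tangent_of u) (tangent_of w) base = D w u - D u w"
    by (simp add: lie_bracket_coord[OF base_chart] field D_def)
  have "value_at_one (D w u - D u w) = \<Theta> (lie_bracket G A (tangent_of u) (tangent_of w))"
    unfolding value_at_one_def br[symmetric] by (simp flip: lie_bracket_tangent_of)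
  also have "\<dots> = ?r (tangent_of u) (value_at_one w) - ?r (tangent_of w) (value_at_one u)"
    using cocycle tangent_of_in unfolding lie_algebra_cocycle_def value_at_one_def by blast
  finally have bracket: "value_at_one (D w u) - value_at_one (D u w) =
      ?r (tangent_of u) (value_at_one w) - ?r (tangent_of w) (value_at_one u)"
    by (simp add: bounded_linear.linear[OF bounded_linear_value_at_one] linear_diff)
  have \<alpha>'_eq: "\<alpha>' w u = ?r (tangent_of w) (value_at_one u) - value_at_one (D u w)" for u w
    using split[of u w] by (metis add_diff_cancel_left')
  have "\<alpha>' u w - \<alpha>' w u = (?r (tangent_of u) (value_at_one w) - ?r (tangent_of w) (value_at_one u)) -
      (value_at_one (D w u) - value_at_one (D u w))"
    unfolding \<alpha>'_eq by (simp add: algebra_simps)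
  then show ?thesis by (simp add: bracket)
qed

text \<open>
  By equivariance the left translation by \<open>g\<close> moves closedness from \<open>e\<close> to \<open>g\<close>.
\<close>
lemma form_closed:
  assumes c: "c \<in> charts_at A g"
    and \<beta>: "((\<lambda>x. cocycle_form c (chart_inv c x)) has_derivative blinfun_apply \<beta>') (at (snd c g))"
  shows "blinfun_apply (blinfun_apply \<beta>' v) w = blinfun_apply (blinfun_apply \<beta>' w) v"
proof -
  let ?o = "snd base \<one>" and ?N = "snd base ` (fst base \<inter> (\<lambda>h. g \<otimes> h) -` fst c)"
  let ?F = "\<lambda>x. snd c (g \<otimes> chart_inv base x)"
  have cA: "c \<in> A" and gc: "g \<in> fst c" using c charts_atD by blast+
  have N: "open ?N" and F: "smooth_on ?N ?F"
    using smooth_map_chart[OF smooth_left_mult base_in_atlas cA] by blast+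
  have o: "?o \<in> ?N" using base_chart gc by (auto dest: charts_atD)
  have dF: "frechet_derivative ?F (at ?o) = left_diff g base c \<one>" by (simp add: left_diff_def)
  have surj: "surj (frechet_derivative ?F (at ?o))"
  proof (rule surjI)
    show "frechet_derivative ?F (at ?o) (left_diff (inv g) c base g v) = v" for v
      using left_diff_compose[of c g base "inv g" c g v] base_chart c left_diff_ident[OF c]
      by (simp add: dF)
  qed
  obtain D where D: "\<And>x. x \<in> snd base ` fst base \<Longrightarrow>
      ((\<lambda>x. cocycle_form base (chart_inv base x)) has_derivative blinfun_apply (D x)) (at x)"
    "smooth_on (snd base ` fst base) D"
    using smooth_on_blinfun_derivative[OF open_image[OF base_in_atlas] smooth_form[OF base_in_atlas]] by blast
  have \<alpha>: "((\<lambda>x. cocycle_form base (chart_inv base x)) has_derivative blinfun_apply (D ?o)) (at ?o)"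
    by (rule D(1)) (use o in blast)
  have pullback: "cocycle_form c (chart_inv c (?F y)) (frechet_derivative ?F (at y) v) = R g (cocycle_form base (chart_inv base y) v)"
    if y: "y \<in> ?N" for y v
  proof -
    obtain h where h: "h \<in> fst base" "g \<otimes> h \<in> fst c" "y = snd base h" using y by blast
    then have "base \<in> charts_at A h" "c \<in> charts_at A (g \<otimes> h)"
      using base_in_atlas cA by (simp_all add: charts_at_def)
    from form_left_diff[OF this] show ?thesis
      using h cA base_in_atlas by (simp add: chart_inv_left left_diff_def)
  qed
  have \<beta>': "((\<lambda>x. cocycle_form c (chart_inv c x)) has_derivative blinfun_apply \<beta>') (at (?F ?o))"
    using \<beta> by (simp add: base_inv)
  show ?thesis
    by (rule closed_pushforward[OF N o F surj \<alpha> \<beta>' pullback form_closed_at_one[OF \<alpha>]])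
qed

text \<open>
  The equation \<open>df = \<omega>\<close> at the point \<open>p\<close>.
\<close>
definition primitive :: "('g \<Rightarrow> 'e) \<Rightarrow> 'g \<Rightarrow> bool" where
  "primitive f p \<longleftrightarrow> (\<forall>c\<in>charts_at A p.
    ((\<lambda>x. f (chart_inv c x)) has_derivative blinfun_apply (cocycle_form c p)) (at (snd c p)))"

lemma primitiveD:
  "primitive f p \<Longrightarrow> c \<in> charts_at A p \<Longrightarrow>
    ((\<lambda>x. f (chart_inv c x)) has_derivative blinfun_apply (cocycle_form c p)) (at (snd c p))"
  by (simp add: primitive_def)

text \<open>
  A change of charts is the left translation by \<open>e\<close>, so equivariance contains independence of the chart.
\<close>
lemma primitive_if_chart:
  assumes c: "c \<in> charts_at A p"
    and f: "((\<lambda>x. f (chart_inv c x)) has_derivative blinfun_apply (cocycle_form c p)) (at (snd c p))"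
  shows "primitive f p"
  unfolding primitive_def
proof
  fix d assume d: "d \<in> charts_at A p"
  have "((\<lambda>x. f (\<one> \<otimes> chart_inv d x)) has_derivative (\<lambda>v. cocycle_form c p (left_diff \<one> d c p v))) (at (snd d p))"
    by (rule left_translate_has_derivative[OF d]) (use c f in simp_all)
  moreover have "cocycle_form c p (left_diff \<one> d c p v) = cocycle_form d p v" for v
    using form_left_diff[OF d, of c \<one> v] c by (simp add: rep_one)
  ultimately show "((\<lambda>x. f (chart_inv d x)) has_derivative blinfun_apply (cocycle_form d p)) (at (snd d p))"
    by simp
qed

lemma primitive_transform:
  assumes f: "primitive f p" and U: "open U" "p \<in> U" and eq: "\<And>q. q \<in> U \<Longrightarrow> g q = f q + k"
  shows "primitive g p"
  unfolding primitive_def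
proof
  fix c assume c: "c \<in> charts_at A p"
  have "((\<lambda>x. f (chart_inv c x) + k) has_derivative blinfun_apply (cocycle_form c p)) (at (snd c p))"
    using has_derivative_add[OF primitiveD[OF f c] has_derivative_const] by simp
  then show "((\<lambda>x. g (chart_inv c x)) has_derivative blinfun_apply (cocycle_form c p)) (at (snd c p))"
    by (rule has_derivative_chart_transform[OF c U]) (simp add: eq)
qed

lemma local_primitive:
  obtains U f where "open U" "path_connected U" "p \<in> U" "\<And>q. q \<in> U \<Longrightarrow> primitive f q"
proof -
  obtain c where c: "c \<in> charts_at A p" using ex_chart_at by blast
  have cA: "c \<in> A" and pc: "p \<in> fst c" using c charts_atD by blast+
  let ?S = "snd c ` fst c"
  obtain r where r: "r > 0" "ball (snd c p) r \<subseteq> ?S"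
    using open_image[OF cA] pc open_contains_ball by (metis imageI)
  let ?B = "ball (snd c p) r"
  have sm: "smooth_on ?B (\<lambda>x. cocycle_form c (chart_inv c x))"
    by (rule smooth_on_subset[OF smooth_form[OF cA] r(2)])
  obtain \<beta> where \<beta>: "\<And>x. x \<in> ?B \<Longrightarrow> ((\<lambda>x. cocycle_form c (chart_inv c x)) has_derivative blinfun_apply (\<beta> x)) (at x)"
    "smooth_on ?B \<beta>"
    using smooth_on_blinfun_derivative[OF open_ball sm] by blast
  have closed: "blinfun_apply (blinfun_apply (\<beta> x) v) w = blinfun_apply (blinfun_apply (\<beta> x) w) v"
    if x: "x \<in> ?B" for x v w
  proof (rule form_closed)
    have xS: "x \<in> ?S" using x r by blast
    then show "c \<in> charts_at A (chart_inv c x)" by (rule charts_at_chart_inv[OF cA])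
    show "((\<lambda>x. cocycle_form c (chart_inv c x)) has_derivative blinfun_apply (\<beta> x)) (at (snd c (chart_inv c x)))"
      using \<beta>(1)[OF x] chart_inv_right[OF cA xS] by simp
  qed
  obtain F where F: "\<And>x. x \<in> ?B \<Longrightarrow> (F has_derivative blinfun_apply (cocycle_form c (chart_inv c x))) (at x)"
    using poincare_convex[OF open_ball convex_ball \<beta>(1) smooth_on_imp_continuous_on[OF \<beta>(2)] closed] by metis
  define U where "U = chart_inv c ` ?B"
  show ?thesis
  proof
    show "open U" unfolding U_def by (rule open_chart_inv_image[OF cA open_ball r(2)])
    have "continuous_on ?B (chart_inv c)"
      using chart_homeomorphism[OF cA] r(2) by (auto simp: homeomorphism_def intro: continuous_on_subset)
    then show "path_connected U"
      unfolding U_def by (intro path_connected_continuous_image convex_imp_path_connected convex_ball)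
    show "p \<in> U"
      unfolding U_def using r by (intro image_eqI[of _ _ "snd c p"]) (simp_all add: chart_inv_left cA pc)
    fix q assume "q \<in> U"
    then obtain x where x: "x \<in> ?B" "q = chart_inv c x" unfolding U_def by blast
    then have xS: "x \<in> ?S" using r by blast
    then have cq: "c \<in> charts_at A q" using x charts_at_chart_inv[OF cA] by simp
    have sx: "snd c q = x" using x chart_inv_right[OF cA xS] by simp
    have "((\<lambda>y. F (snd c (chart_inv c y))) has_derivative blinfun_apply (cocycle_form c q)) (at x)"
    proof (rule has_derivative_transform_within_open[OF _ open_ball x(1)])
      show "(F has_derivative blinfun_apply (cocycle_form c q)) (at x)" using F[OF x(1)] x(2) by simp
      show "F y = F (snd c (chart_inv c y))" if "y \<in> ?B" for y
        using that r(2) chart_inv_right[OF cA, of y] by auto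
    qed
    then show "primitive (\<lambda>q. F (snd c q)) q"
      using primitive_if_chart[OF cq] sx by simp
  qed
qed

lemma global_primitive:
  assumes sc: "simply_connected (UNIV :: 'g set)"
  obtains \<theta> where "\<theta> \<one> = 0" "\<And>p. primitive \<theta> p"
proof -
  define S where "S = {(U, f). open U \<and> path_connected U \<and> (\<forall>q\<in>U. primitive f q)}"
  interpret local_sections S
  proof
    show "\<exists>U f. (U, f) \<in> S \<and> p \<in> U" for p
    proof -
      obtain U f where "open U" "path_connected U" "p \<in> U" "\<And>q. q \<in> U \<Longrightarrow> primitive f q"
        using local_primitive by blast
      then show ?thesis by (intro exI[of _ U] exI[of _ f]) (simp add: S_def)
    qed
    fix U f V g p assume *: "(U, f) \<in> S" "(V, g) \<in> S" "p \<in> U" "p \<in> V"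
    have "\<exists>D. ((\<lambda>x. f (chart_inv c x)) has_derivative D) (at (snd c q)) \<and>
        ((\<lambda>x. g (chart_inv c x)) has_derivative D) (at (snd c q))"
      if "q \<in> U \<inter> V" "c \<in> charts_at A q" for q c
      using that * primitiveD unfolding S_def by blast
    with * obtain W k where "open W" "p \<in> W" "\<And>q. q \<in> W \<Longrightarrow> f q = g q + k"
      using equal_derivatives_imp_locally_constant_difference[of "U \<inter> V" p f g]
      unfolding S_def by (metis (no_types, lifting) IntI case_prodD mem_Collect_eq open_Int)
    then show "\<exists>W k. open W \<and> p \<in> W \<and> (\<forall>q\<in>W. f q = g q + k)" by blast
  qed (auto simp: S_def)
  obtain \<theta> where \<theta>: "\<And>U f. (U, f) \<in> S \<Longrightarrow> \<exists>k. \<forall>q\<in>U. \<theta> q = f q + k"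
    using global_section[OF sc] by blast
  have "primitive (\<lambda>q. \<theta> q - \<theta> \<one>) p" for p
  proof -
    obtain U f where U: "(U, f) \<in> S" "p \<in> U" using section_cover by blast
    obtain k where k: "\<And>q. q \<in> U \<Longrightarrow> \<theta> q = f q + k" using \<theta>[OF U(1)] by blast
    show ?thesis
      by (rule primitive_transform[where U = U and f = f and k = "k - \<theta> \<one>"])
        (use U k in \<open>auto simp: S_def\<close>)
  qed
  then show ?thesis using that[of "\<lambda>q. \<theta> q - \<theta> \<one>"] by simp
qed

lemma primitive_imp_smooth:
  assumes "\<And>p. primitive \<theta> p"
  shows "smooth_map A vs_atlas \<theta>"
  unfolding smooth_map_vs_iff
proof (intro conjI ballI)
  show "continuous_on UNIV \<theta>"
    by (rule chart_derivative_imp_continuous) (use primitiveD[OF assms] in blast)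
  fix c assume c: "c \<in> A"
  show "smooth_on (snd c ` fst c) (\<lambda>x. \<theta> (chart_inv c x))"
  proof (rule smooth_on_if_derivative_smooth[OF open_image[OF c]])
    show "((\<lambda>x. \<theta> (chart_inv c x)) has_derivative blinfun_apply (cocycle_form c (chart_inv c x))) (at x)"
      if "x \<in> snd c ` fst c" for x
      using primitiveD[OF assms charts_at_chart_inv[OF c that]] chart_inv_right[OF c that] by simp
    show "smooth_on (snd c ` fst c) (\<lambda>x. cocycle_form c (chart_inv c x) v)" for v
      by (rule smooth_on_bounded_linear[OF open_image[OF c] blinfun.bounded_linear_left smooth_form[OF c]])
  qed
qed

text \<open>
  As functions of \<open>h\<close>, both \<open>\<theta>(gh)\<close> and \<open>R(g)(\<theta>(h))\<close> have the derivative \<open>R(g) \<omega>\<close>, by equivariance.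
\<close>
lemma primitive_imp_cocycle:
  assumes conn: "connected (UNIV :: 'g set)" and prim: "\<And>p. primitive \<theta> p" and one: "\<theta> \<one> = 0"
  shows "lie_group_cocycle G A R \<theta>"
  unfolding lie_group_cocycle_def
proof (intro conjI ballI)
  show "smooth_map A vs_atlas \<theta>" using prim by (rule primitive_imp_smooth)
  fix g h
  have "\<theta> (g \<otimes> h) - R g (\<theta> h) = \<theta> (g \<otimes> \<one>) - R g (\<theta> \<one>)"
  proof (rule equal_derivatives_imp_constant_difference[OF conn])
    fix q c assume c: "c \<in> charts_at A q"
    obtain d where d: "d \<in> charts_at A (g \<otimes> q)" using ex_chart_at by blast
    have "((\<lambda>x. \<theta> (g \<otimes> chart_inv c x)) has_derivative (\<lambda>v. R g (cocycle_form c q v))) (at (snd c q))"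
      using left_translate_has_derivative[OF c d primitiveD[OF prim d]]
      by (simp add: form_left_diff c d)
    moreover have "((\<lambda>x. R g (\<theta> (chart_inv c x))) has_derivative (\<lambda>v. R g (cocycle_form c q v))) (at (snd c q))"
      by (rule bounded_linear.has_derivative[OF blinfun.bounded_linear_right primitiveD[OF prim c]])
    ultimately show "\<exists>D. ((\<lambda>x. \<theta> (g \<otimes> chart_inv c x)) has_derivative D) (at (snd c q)) \<and>
        ((\<lambda>x. R g (\<theta> (chart_inv c x))) has_derivative D) (at (snd c q))"
      by blast
  qed
  then show "\<theta> (g \<otimes> h) = R g (\<theta> h) + \<theta> g" by (simp add: one algebra_simps)
qed

lemma primitive_imp_integrates:
  assumes "primitive \<theta> \<one>"
  shows "integrates G A \<theta> \<Theta>"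
  unfolding integrates_def
proof
  fix X assume X: "X \<in> lie_algebra G A"
  have "frechet_derivative (\<lambda>x. \<theta> (chart_inv base x)) (at (snd base \<one>)) = blinfun_apply (cocycle_form base \<one>)"
    using frechet_derivative_at[OF primitiveD[OF assms base_chart]] by simp
  then show "\<Theta> X = vs_tangent_map A \<theta> \<one> X"
    by (simp add: vs_tangent_map_eq form_one value_at_one_def lie_algebra_eq_tangent_of[OF X])
qed

text \<open>
  The cocycle identity in the form \<open>\<theta>(q) = R(p)(\<theta>(p\<^sup>-\<^sup>1q)) + \<theta>(p)\<close> expresses \<open>\<theta>\<close> near \<open>p\<close> by \<open>\<theta>\<close> near \<open>e\<close>, where
  its derivative is \<open>\<Theta>\<close>.
\<close>
lemma cocycle_imp_primitive:
  assumes \<theta>: "lie_group_cocycle G A R \<theta>" and int: "integrates G A \<theta> \<Theta>"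
  shows "primitive \<theta> p"
  unfolding primitive_def
proof
  fix c assume c: "c \<in> charts_at A p"
  have sm: "smooth_map A vs_atlas \<theta>" and mult: "\<theta> (g \<otimes> h) = R g (\<theta> h) + \<theta> g" for g h
    using \<theta> unfolding lie_group_cocycle_def by simp_all
  have "frechet_derivative (\<lambda>x. \<theta> (chart_inv base x)) (at (snd base \<one>)) u = value_at_one u" for u
    using int tangent_of_in[of u] unfolding integrates_def value_at_one_def by (simp add: vs_tangent_map_eq)
  then have "frechet_derivative (\<lambda>x. \<theta> (chart_inv base x)) (at (snd base \<one>)) = value_at_one" by (rule ext)
  then have one: "((\<lambda>x. \<theta> (chart_inv base x)) has_derivative value_at_one) (at (snd base \<one>))"
    using smooth_map_vs_has_derivative[OF sm base_chart] by simp
  have "((\<lambda>x. \<theta> (inv p \<otimes> chart_inv c x)) has_derivative (\<lambda>v. value_at_one (maurer_cartan c p v))) (at (snd c p))"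
    unfolding maurer_cartan_def
    by (rule left_translate_has_derivative[OF c]) (use base_chart one in simp_all)
  note bounded_linear.has_derivative[OF blinfun.bounded_linear_right[of "R p"] this]
  from has_derivative_add[OF this has_derivative_const[of "\<theta> p"]]
  have "((\<lambda>x. R p (\<theta> (inv p \<otimes> chart_inv c x)) + \<theta> p) has_derivative blinfun_apply (cocycle_form c p)) (at (snd c p))"
    by (simp flip: form_apply[OF c])
  moreover have "R p (\<theta> (inv p \<otimes> q)) + \<theta> p = \<theta> q" for q
    using mult[of p "inv p \<otimes> q"] by (simp flip: m_assoc)
  ultimately show "((\<lambda>x. \<theta> (chart_inv c x)) has_derivative blinfun_apply (cocycle_form c p)) (at (snd c p))"
    by simp
qed

lemma cocycle_one:
  assumes "lie_group_cocycle G A R \<theta>"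
  shows "\<theta> \<one> = 0"
proof -
  have "\<theta> (\<one> \<otimes> \<one>) = R \<one> (\<theta> \<one>) + \<theta> \<one>"
    using assms unfolding lie_group_cocycle_def by blast
  then show ?thesis by (simp add: rep_one)
qed

lemma integrating_cocycle_unique:
  assumes conn: "connected (UNIV :: 'g set)"
    and "lie_group_cocycle G A R \<theta>" "integrates G A \<theta> \<Theta>"
    and "lie_group_cocycle G A R \<theta>'" "integrates G A \<theta>' \<Theta>"
  shows "\<theta> = \<theta>'"
proof
  fix g
  have "\<theta> g - \<theta>' g = \<theta> \<one> - \<theta>' \<one>"
    by (rule equal_derivatives_imp_constant_difference[OF conn])
      (use primitiveD[OF cocycle_imp_primitive] assms in blast)
  then show "\<theta> g = \<theta>' g" using cocycle_one[OF assms(2)] cocycle_one[OF assms(4)] by simp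
qed

lemma coboundary_tangent:
  assumes "\<And>g. \<theta> g = R g v - v"
  shows "vs_tangent_map A \<theta> \<one> X = lie_algebra_rep G A R X v"
proof -
  have "((\<lambda>x. R (chart_inv base x) v - v) has_derivative
      (\<lambda>u. lie_algebra_rep G A R (tangent_of u) v)) (at (snd base \<one>))"
    using has_derivative_diff[OF bounded_linear.has_derivative[OF blinfun.bounded_linear_left rep_diff] has_derivative_const]
    by simp
  then have "frechet_derivative (\<lambda>x. \<theta> (chart_inv base x)) (at (snd base \<one>)) (X base) =
      lie_algebra_rep G A R (tangent_of (X base)) v"
    unfolding assms by (metis frechet_derivative_at)
  then show ?thesis by (simp add: vs_tangent_map_eq lie_algebra_rep_def)
qed

lemma coboundary_is_cocycle: "lie_group_cocycle G A R (\<lambda>g. R g v - v)"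
  unfolding lie_group_cocycle_def
proof (intro conjI ballI)
  have R: "smooth_on (snd c ` fst c) (\<lambda>x. R (chart_inv c x))" if "c \<in> A" for c
    using smooth_rep that by (simp add: smooth_map_vs_iff)
  have "continuous_on UNIV R" using smooth_rep by (simp add: smooth_map_vs_iff)
  then have "continuous_on UNIV (\<lambda>g. R g v - v)" by (intro continuous_intros)
  moreover have "smooth_on (snd c ` fst c) (\<lambda>x. R (chart_inv c x) v - v)" if c: "c \<in> A" for c
  proof -
    note S = open_image[OF c]
    have "smooth_on (snd c ` fst c) (\<lambda>x. R (chart_inv c x) v + - v)"
      by (rule smooth_on_add[OF S smooth_on_bounded_linear[OF S blinfun.bounded_linear_left R[OF c]] smooth_on_const[OF S]])
    then show ?thesis by simp
  qed
  ultimately show "smooth_map A vs_atlas (\<lambda>g. R g v - v)" by (simp add: smooth_map_vs_iff)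
  show "R (g \<otimes> h) v - v = R g (R h v - v) + (R g v - v)" for g h
    by (simp add: rep_mult blinfun.diff_right)
qed

lemma coboundary_iff:
  assumes conn: "connected (UNIV :: 'g set)"
    and \<theta>: "lie_group_cocycle G A R \<theta>" "integrates G A \<theta> \<Theta>"
  shows "lie_group_coboundary G R \<theta> \<longleftrightarrow> lie_algebra_coboundary G A (lie_algebra_rep G A R) \<Theta>"
proof
  assume "lie_group_coboundary G R \<theta>"
  then obtain v where "\<And>g. \<theta> g = R g v - v" by (auto simp: lie_group_coboundary_def)
  from coboundary_tangent[OF this] \<theta>(2)
  show "lie_algebra_coboundary G A (lie_algebra_rep G A R) \<Theta>"
    unfolding lie_algebra_coboundary_def integrates_def by auto
next
  assume "lie_algebra_coboundary G A (lie_algebra_rep G A R) \<Theta>"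
  then obtain v where v: "\<And>X. X \<in> lie_algebra G A \<Longrightarrow> \<Theta> X = lie_algebra_rep G A R X v"
    by (auto simp: lie_algebra_coboundary_def)
  have "integrates G A (\<lambda>g. R g v - v) \<Theta>"
    unfolding integrates_def by (simp add: v coboundary_tangent)
  then have "\<theta> = (\<lambda>g. R g v - v)"
    by (rule integrating_cocycle_unique[OF conn \<theta> coboundary_is_cocycle])
  then show "lie_group_coboundary G R \<theta>" by (auto simp: lie_group_coboundary_def)
qed

end

theorem proposition4p2p14:
  fixes G :: "('g::{t2_space, second_countable_topology}, 'm) monoid_scheme"
    and A :: "('g, 'v::fin_dim_normed_vector) chart set"
    and R :: "'g \<Rightarrow> 'e::fin_dim_normed_vector \<Rightarrow>\<^sub>L 'e"
    and r :: "('g, 'v) tangent \<Rightarrow> 'e \<Rightarrow>\<^sub>L 'e"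
    and \<Theta> :: "('g, 'v) tangent \<Rightarrow> 'e"
  assumes "lie_group G A"
    and "connected (UNIV :: 'g set)"
    and "simply_connected (UNIV :: 'g set)"
    and "lie_group_rep G A R"
    and "r = lie_algebra_rep G A R"
    and "lie_algebra_cocycle G A r \<Theta>"
  shows "(\<exists>!\<theta>. lie_group_cocycle G A R \<theta> \<and> integrates G A \<theta> \<Theta>) \<and>
    (\<forall>\<theta>. lie_group_cocycle G A R \<theta> \<and> integrates G A \<theta> \<Theta> \<longrightarrow>
      (lie_group_coboundary G R \<theta> \<longleftrightarrow> lie_algebra_coboundary G A r \<Theta>))"
proof -
  interpret lie_group G A by fact
  interpret lie_algebra_one_cocycle G A R \<Theta>
    by unfold_locales (use assms(4-6) in simp_all)
  obtain \<theta> where \<theta>: "\<theta> \<one>\<^bsub>G\<^esub> = 0" "\<And>p. primitive \<theta> p"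
    using global_primitive[OF assms(3)] by blast
  have "lie_group_cocycle G A R \<theta>" "integrates G A \<theta> \<Theta>"
    using primitive_imp_cocycle[OF assms(2) \<theta>(2,1)] primitive_imp_integrates[OF \<theta>(2)] by blast+
  then have "\<exists>!\<theta>. lie_group_cocycle G A R \<theta> \<and> integrates G A \<theta> \<Theta>"
    using integrating_cocycle_unique[OF assms(2)] by blast
  then show ?thesis using coboundary_iff[OF assms(2)] assms(5) by blast
qed

end
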